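(* Let $n, c$ be positive integers with $n^2 - n + 1 < c \leq n^2$. Let $p_c = (u_2 \mid u_{c-1} \mid u_c)$, where $u_m = (1/m, \ldots, 1/m)$ is the uniform probability vector of length $m$, padded with zeros as needed. Then $p_c \in \Delta(\langle c \rangle)$ and $p_c \notin \Delta(\mathsf{M}_n)$. In particular $\Delta(\langle c\rangle) \not\subseteq \Delta(\mathsf{M}_n)$, and in particular $\Delta(\langle n^2\rangle) \not\subseteq \Delta(\mathsf{M}_n)$ for every $n \in \mathbb{N}$.
   Context: For $T \in \mathbb{C}^a \otimes \mathbb{C}^b \otimes \mathbb{C}^c$ nonzero, let $T_1\colon \mathbb{C}^a \to \mathbb{C}^b\otimes\mathbb{C}^c$, $T_2\colon\mathbb{C}^b \to \mathbb{C}^a\otimes\mathbb{C}^c$, $T_3\colon \mathbb{C}^c\to\mathbb{C}^a\otimes\mathbb{C}^b$ be the flattenings, and $\mu_i(T) = T_i^*T_i/\|T\|^2$. For a positive semidefinite matrix $M$, $\mathrm{spec}(M)$ is its vector of eigenvalues in non-increasing order, and $\mathrm{spec}(\mu(T)) = (\mathrm{spec}(\mu_1(T)) \mid \mathrm{spec}(\mu_2(T)) \mid \mathrm{spec}(\mu_3(T))) \in \mathbb{R}^a\times\mathbb{R}^b\times\mathbb{R}^c$. The group $\mathrm{GL} = \mathrm{GL}_a\times\mathrm{GL}_b\times\mathrm{GL}_c$ acts by $(A,B,C)\cdot T = (A\otimes B\otimes C)T$. The moment polytope of $T$ is $\Delta(T) = \{\mathrm{spec}(\mu(S)) : S \in \overline{\mathrm{GL}\cdot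 T}\setminus\{0\}\}$ (closure in the Euclidean topology). Moment polytopes of tensors living in different spaces, and points of different lengths, are compared after padding each of the three components with zeros so that all live in the same space $\mathbb{R}^{a}\times\mathbb{R}^{b}\times\mathbb{R}^{c}$. The unit tensor is $\langle r\rangle = \sum_{i=1}^r e_i\otimes e_i\otimes e_i \in (\mathbb{C}^r)^{\otimes 3}$. The matrix multiplication tensor is $\mathsf{M}_n = \sum_{i,j,k=1}^n e_{i,j}\otimes e_{j,k}\otimes e_{k,i} \in \mathbb{C}^{n^2}\otimes\mathbb{C}^{n^2}\otimes\mathbb{C}^{n^2}$, where $e_{i,j}$ are standard basis vectors of $\mathbb{C}^{n^2}=\mathbb{C}^{n\times n}$.
   Formalization: The final claim Δ(⟨n²⟩) ⊄ Δ(M_n) is proved for every n ≥ 2 rather than every n ∈ ℕ; for n = 1 it is false, since M_1 = ⟨1⟩ and the two polytopes coincide. *)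

theory Defs
  imports "HOL-Analysis.Function_Metric" "Jordan_Normal_Form.Schur_Decomposition"
begin

text \<open>
  An element of \<open>\<complex>\<^sup>a \<otimes> \<complex>\<^sup>b \<otimes> \<complex>\<^sup>c\<close> is given by its coordinates with respect to the standard basis,
  indexed from \<open>0\<close> and extended by \<open>0\<close> outside the index range.
\<close>

type_synonym tensor = "nat \<Rightarrow> nat \<Rightarrow> nat \<Rightarrow> complex"

definition tensor_space :: "nat \<Rightarrow> nat \<Rightarrow> nat \<Rightarrow> tensor set" where
  "tensor_space a b c = {T. \<forall>i j k. T i j k \<noteq> 0 \<longrightarrow> i < a \<and> j < b \<and> k < c}"

definition tensor_norm :: "nat \<Rightarrow> nat \<Rightarrow> nat \<Rightarrow> tensor \<Rightarrow> real" where
  "tensor_norm a b c T = sqrt (\<Sum>i<a. \<Sum>j<b. \<Sum>k<c. (cmod (T i j k))\<^sup>2)"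

text \<open>
  Matrices of the flattenings, e.g. \<open>T\<^sub>1 e\<^sub>i = (\<Sum>j k. T i j k e\<^sub>j \<otimes> e\<^sub>k)\<close>, where \<open>e\<^sub>j \<otimes> e\<^sub>k\<close> is the
  basis vector number \<open>j * c + k\<close> of \<open>\<complex>\<^sup>b \<otimes> \<complex>\<^sup>c\<close>.
\<close>

definition flat1 :: "nat \<Rightarrow> nat \<Rightarrow> nat \<Rightarrow> tensor \<Rightarrow> complex mat" where
  "flat1 a b c T = Matrix.mat (b * c) a (\<lambda>(r, i). T i (r div c) (r mod c))"

definition flat2 :: "nat \<Rightarrow> nat \<Rightarrow> nat \<Rightarrow> tensor \<Rightarrow> complex mat" where
  "flat2 a b c T = Matrix.mat (a * c) b (\<lambda>(r, j). T (r div c) j (r mod c))"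

definition flat3 :: "nat \<Rightarrow> nat \<Rightarrow> nat \<Rightarrow> tensor \<Rightarrow> complex mat" where
  "flat3 a b c T = Matrix.mat (a * b) c (\<lambda>(r, k). T (r div b) (r mod b) k)"

definition moment1 :: "nat \<Rightarrow> nat \<Rightarrow> nat \<Rightarrow> tensor \<Rightarrow> complex mat" where
  "moment1 a b c T = complex_of_real (1 / (tensor_norm a b c T)\<^sup>2) \<cdot>\<^sub>m
     (mat_adjoint (flat1 a b c T) * flat1 a b c T)"

definition moment2 :: "nat \<Rightarrow> nat \<Rightarrow> nat \<Rightarrow> tensor \<Rightarrow> complex mat" where
  "moment2 a b c T = complex_of_real (1 / (tensor_norm a b c T)\<^sup>2) \<cdot>\<^sub>m
     (mat_adjoint (flat2 a b c T) * flat2 a b c T)"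

definition moment3 :: "nat \<Rightarrow> nat \<Rightarrow> nat \<Rightarrow> tensor \<Rightarrow> complex mat" where
  "moment3 a b c T = complex_of_real (1 / (tensor_norm a b c T)\<^sup>2) \<cdot>\<^sub>m
     (mat_adjoint (flat3 a b c T) * flat3 a b c T)"

text \<open>
  Eigenvalues counted with algebraic multiplicity. Taking real parts loses nothing for the positive
  semidefinite matrices to which this is applied.
\<close>

definition spec :: "complex mat \<Rightarrow> real list" where
  "spec M = rev (sorted_list_of_multiset (image_mset Re (proots (char_poly M))))"

type_synonym point = "real list \<times> real list \<times> real list"

definition spec_moment :: "nat \<Rightarrow> nat \<Rightarrow> nat \<Rightarrow> tensor \<Rightarrow> point" where
  "spec_moment a b c T = (spec (moment1 a b c T), spec (moment2 a b c T), spec (moment3 a b c T))"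

definition GL :: "nat \<Rightarrow> complex mat set" where
  "GL n = {A \<in> carrier_mat n n. invertible_mat A}"

definition tensor_act ::
  "nat \<Rightarrow> nat \<Rightarrow> nat \<Rightarrow> complex mat \<Rightarrow> complex mat \<Rightarrow> complex mat \<Rightarrow> tensor \<Rightarrow> tensor" where
  "tensor_act a b c A B C T = (\<lambda>i j k.
     if i < a \<and> j < b \<and> k < c
     then (\<Sum>i'<a. \<Sum>j'<b. \<Sum>k'<c. A $$ (i, i') * B $$ (j, j') * C $$ (k, k') * T i' j' k')
     else 0)"

definition GL_orbit :: "nat \<Rightarrow> nat \<Rightarrow> nat \<Rightarrow> tensor \<Rightarrow> tensor set" where
  "GL_orbit a b c T = {tensor_act a b c A B C T | A B C. A \<in> GL a \<and> B \<in> GL b \<and> C \<in> GL c}"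

text \<open>
  The closure is taken in the product topology on functions. On \<open>tensor_space a b c\<close>, which is closed
  in it, this is the Euclidean topology; see \<open>closure_tensor_space\<close> below.
\<close>

definition moment_polytope :: "nat \<Rightarrow> nat \<Rightarrow> nat \<Rightarrow> tensor \<Rightarrow> point set" where
  "moment_polytope a b c T =
     {spec_moment a b c S | S. S \<in> closure (GL_orbit a b c T) - {\<lambda>_ _ _. 0}}"

lemma GL_orbit_subset: "GL_orbit a b c T \<subseteq> tensor_space a b c"
  by (auto simp: GL_orbit_def tensor_act_def tensor_space_def split: if_splits)

lemma continuous_on_coord [continuous_intros]: "continuous_on A (\<lambda>T :: tensor. T i j k)"
proof -
  have "continuous_on A (\<lambda>T :: tensor. T i)"
    by (rule continuous_on_product_then_coordinatewise[OF continuous_on_id])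
  then have "continuous_on A (\<lambda>T :: tensor. T i j)"
    by (rule continuous_on_product_then_coordinatewise)
  then show ?thesis
    by (rule continuous_on_product_then_coordinatewise)
qed

lemma tendsto_fun_coordwise:
  fixes f :: "'i \<Rightarrow> 'a \<Rightarrow> 'b :: topological_space"
  assumes "\<And>x. ((\<lambda>n. f n x) \<longlongrightarrow> l x) F"
  shows "(f \<longlongrightarrow> l) F"
  using assms limitin_componentwise[of "\<lambda>_. euclidean" UNIV f l F]
  by (simp add: euclidean_product_topology flip: limitin_canonical_iff)

lemma closed_tensor_space: "closed (tensor_space a b c)"
proof -
  have "tensor_space a b c =
    (\<Inter>i. \<Inter>j. \<Inter>k. {T. (if i < a \<and> j < b \<and> k < c then 0 else T i j k) = 0})"
    by (auto simp: tensor_space_def)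
  moreover have "closed {T :: tensor. (if i < a \<and> j < b \<and> k < c then 0 else T i j k) = 0}" for i j k
    by (cases "i < a \<and> j < b \<and> k < c")
      (auto intro!: closed_Collect_eq continuous_on_coord continuous_on_const)
  ultimately show ?thesis by (simp only:) (intro closed_INT ballI)
qed

lemma cmod_le_tensor_norm:
  assumes "i < a" "j < b" "k < c"
  shows "cmod (T i j k) \<le> tensor_norm a b c T"
proof -
  have "(cmod (T i j k))\<^sup>2 \<le> (\<Sum>k<c. (cmod (T i j k))\<^sup>2)"
    using assms by (intro member_le_sum) auto
  also have "\<dots> \<le> (\<Sum>j<b. \<Sum>k<c. (cmod (T i j k))\<^sup>2)"
    using assms by (intro member_le_sum[of j _ "\<lambda>j. \<Sum>k<c. (cmod (T i j k))\<^sup>2"] sum_nonneg) auto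
  also have "\<dots> \<le> (\<Sum>i<a. \<Sum>j<b. \<Sum>k<c. (cmod (T i j k))\<^sup>2)"
    using assms by (intro member_le_sum[of i _ "\<lambda>i. \<Sum>j<b. \<Sum>k<c. (cmod (T i j k))\<^sup>2"] sum_nonneg) auto
  finally show ?thesis
    unfolding tensor_norm_def by (rule real_le_rsqrt)
qed

lemma closure_tensor_space:
  assumes X: "X \<subseteq> tensor_space a b c"
  shows "S \<in> closure X \<longleftrightarrow> S \<in> tensor_space a b c \<and>
    (\<forall>e>0. \<exists>R\<in>X. tensor_norm a b c (\<lambda>i j k. S i j k - R i j k) < e)"
    (is "?L \<longleftrightarrow> ?R1 \<and> ?R2")
proof (intro iffI conjI allI impI)
  assume ?L
  then show ?R1 using closure_minimal[OF X closed_tensor_space] by blast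
next
  fix e :: real assume L: ?L and e: "e > 0"
  let ?U = "{R. tensor_norm a b c (\<lambda>i j k. S i j k - R i j k) < e}"
  have "open ?U"
    unfolding tensor_norm_def by (intro open_Collect_less continuous_intros)
  moreover have "S \<in> ?U" using e by (simp add: tensor_norm_def)
  ultimately show "\<exists>R\<in>X. tensor_norm a b c (\<lambda>i j k. S i j k - R i j k) < e"
    using L open_Int_closure_eq_empty[of ?U X] by blast
next
  assume R: "?R1 \<and> ?R2"
  have "\<forall>n. \<exists>R. R \<in> X \<and>
      tensor_norm a b c (\<lambda>i j k. S i j k - R i j k) < inverse (real (Suc n))"
    using R by (simp add: Bex_def)
  from choice[OF this] obtain Q where QX: "\<And>n. Q n \<in> X"
    and Q: "\<And>n. tensor_norm a b c (\<lambda>i j k. S i j k - Q n i j k) < inverse (real (Suc n))"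
    by auto
  have "(\<lambda>n. Q n i j k) \<longlonglongrightarrow> S i j k" for i j k
  proof (cases "i < a \<and> j < b \<and> k < c")
    case True
    have "norm (Q n i j k - S i j k) \<le> inverse (real (Suc n))" for n
      using cmod_le_tensor_norm[of i a j b k c "\<lambda>i j k. S i j k - Q n i j k"] True Q[of n]
      by (simp add: norm_minus_commute)
    then have "(\<lambda>n. Q n i j k - S i j k) \<longlonglongrightarrow> 0"
      by (intro tendsto_0_le[OF LIMSEQ_inverse_real_of_nat, of _ 1]) auto
    then show ?thesis by (simp add: LIM_zero_iff)
  next
    case False
    moreover have "S \<in> tensor_space a b c" "\<And>n. Q n \<in> tensor_space a b c"
      using R QX X by blast+
    ultimately have "S i j k = 0" "\<And>n. Q n i j k = 0"
      unfolding tensor_space_def by blast+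
    then show ?thesis by simp
  qed
  then have "Q \<longlonglongrightarrow> S" by (intro tendsto_fun_coordwise)
  then show ?L using QX closure_sequential by blast
qed

definition std_basis :: "nat \<Rightarrow> nat \<Rightarrow> complex" where
  "std_basis p = (\<lambda>i. if i = p then 1 else 0)"

definition unit_tensor :: "nat \<Rightarrow> tensor" where
  "unit_tensor r = (\<lambda>x y z. \<Sum>i<r. std_basis i x * std_basis i y * std_basis i z)"

text \<open>The basis vector \<open>e\<^sub>i\<^sub>,\<^sub>j\<close> of \<open>\<complex>\<^sup>n\<^sup>\<times>\<^sup>n\<close> is basis vector number \<open>i * n + j\<close>.\<close>

definition matmul_tensor :: "nat \<Rightarrow> tensor" where
  "matmul_tensor n = (\<lambda>x y z. \<Sum>i<n. \<Sum>j<n. \<Sum>k<n.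
     std_basis (i * n + j) x * std_basis (j * n + k) y * std_basis (k * n + i) z)"

abbreviation unit_polytope :: "nat \<Rightarrow> point set" where
  "unit_polytope r \<equiv> moment_polytope r r r (unit_tensor r)"

abbreviation matmul_polytope :: "nat \<Rightarrow> point set" where
  "matmul_polytope n \<equiv> moment_polytope (n\<^sup>2) (n\<^sup>2) (n\<^sup>2) (matmul_tensor n)"

definition pad :: "nat \<Rightarrow> real list \<Rightarrow> real list" where
  "pad m xs = xs @ replicate (m - length xs) 0"

definition pad3 :: "nat \<Rightarrow> point \<Rightarrow> point" where
  "pad3 m = (\<lambda>(x, y, z). (pad m x, pad m y, pad m z))"

definition uniform_vec :: "nat \<Rightarrow> real list" where
  "uniform_vec m = replicate m (1 / real m)"

definition p_point :: "nat \<Rightarrow> point" where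
  "p_point c = (uniform_vec 2, uniform_vec (c - 1), uniform_vec c)"

end

theory Submission
  imports Defs "HOL-Analysis.Topology_Euclidean_Space" "HOL-Analysis.Convex"
begin

text \<open>
  A tensor with marginal spectra \<open>(u\<^sub>2 | u\<^sub>c\<^sub>-\<^sub>1 | u\<^sub>c)\<close> is, after a unitary change of bases, a pencil
  \<open>(S\<^sub>0, S\<^sub>1)\<close> of \<open>(c - 1) \<times> c\<close> matrices. Every nonzero combination of \<open>S\<^sub>0\<close> and \<open>S\<^sub>1\<close> has full rank
  \<open>c - 1\<close>: by unitary invariance consider \<open>S\<^sub>0\<close>; a unit vector \<open>v\<close> with \<open>v\<^sup>* S\<^sub>0 = 0\<close> would give
  \<open>1 / (c - 1) = |v\<^sup>* S\<^sub>1|\<^sup>2 \<le> 1 / c\<close>. On the other hand, two slices of a tensor in the orbit of the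
  matrix multiplication tensor have a nonzero combination of rank at most \<open>n\<^sup>2 - n\<close>, because a pencil
  of \<open>n \<times> n\<close> matrices contains a singular one, and this property passes to limits. Conversely the
  pencil describing multiplication by a linear polynomial has rank \<open>c\<close>, and a diagonal scaling of it
  has the required marginals.
\<close>

section \<open>Unitary diagonalization\<close>

text \<open>The bound on \<open>c\<close> says that \<open>c - 1\<close> exceeds
  \<open>n\<^sup>2 - n\<close>, the rank of \<open>X \<otimes> 1\<close> for \<open>X\<close> of
  rank \<open>n - 1\<close>. The pencil must not be square: every square complex pencil has a
  singular member, so no full-rank statement could hold for two equal uniform marginals. The gap
  between \<open>1 / (c - 1)\<close> and \<open>1 / c\<close> is what excludes a kernel vector.
  Marginal spectra are invariant only under unitary changes of bases, but an orbit closure is stable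
  under all of \<open>GL\<close>, so the marginals can be diagonalised inside it. Since the closure
  contains more than the orbit, rank deficiency has to be stated as a closed condition. The weights
  come from a recurrence. With \<open>N = c - 1\<close> and squared entries \<open>w0 j\<close>,
  \<open>w1 j\<close> of the two slices, uniform marginals mean \<open>w0 j + w1 j = 1 / N\<close>
  and \<open>w0 k + w1 (k - 1) = 1 / (N + 1)\<close>. Starting from
  \<open>w0 0 = 1 / (N + 1)\<close> this gives \<open>w0 j = (N - j) / (N (N + 1))\<close> and
  \<open>w1 j = (j + 1) / (N (N + 1))\<close>. The reversal of \<open>j\<close> exchanges the
  slices, so the first marginal is then uniform as well.\<close>

definition unitary_mat :: "nat \<Rightarrow> complex mat \<Rightarrow> bool" where
  "unitary_mat n U \<longleftrightarrow> U \<in> carrier_mat n n \<and> mat_adjoint U * U = 1\<^sub>m n \<and> U * mat_adjoint U = 1\<^sub>m n"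

definition hermitian_mat :: "complex mat \<Rightarrow> bool" where
  "hermitian_mat A \<longleftrightarrow> mat_adjoint A = A"

lemma dim_mat_adjoint [simp]:
  "dim_row (mat_adjoint A) = dim_col A" "dim_col (mat_adjoint A) = dim_row A"
  by (auto simp: mat_adjoint_def)

lemma mat_adjoint_carrier [simp]: "A \<in> carrier_mat n m \<Longrightarrow> mat_adjoint A \<in> carrier_mat m n"
  by (intro carrier_matI) simp_all

lemma index_mat_adjoint [simp]:
  fixes A :: "complex mat"
  assumes "i < dim_col A" "j < dim_row A"
  shows "mat_adjoint A $$ (i, j) = cnj (A $$ (j, i))"
  using assms by (simp add: mat_adjoint_def mat_of_rows_def conjugate_complex_def)

lemma mat_adjoint_mult:
  fixes A B :: "complex mat"
  assumes "A \<in> carrier_mat n m" "B \<in> carrier_mat m k"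
  shows "mat_adjoint (A * B) = mat_adjoint B * mat_adjoint A"
  using assms by (intro eq_matI) (auto simp: scalar_prod_def mult.commute)

lemma mat_adjoint_adjoint [simp]: "mat_adjoint (mat_adjoint A) = (A :: complex mat)"
  by (intro eq_matI) auto

lemma unitary_matI:
  assumes "U \<in> carrier_mat n n" "mat_adjoint U * U = 1\<^sub>m n"
  shows "unitary_mat n U"
  using assms mat_mult_left_right_inverse[of "mat_adjoint U" n U]
  by (simp add: unitary_mat_def)

lemma unitary_mat_mult:
  assumes "unitary_mat n U" "unitary_mat n V"
  shows "unitary_mat n (U * V)"
proof (rule unitary_matI)
  show "U * V \<in> carrier_mat n n" using assms by (auto simp: unitary_mat_def)
  have "mat_adjoint (U * V) * (U * V) = mat_adjoint V * (mat_adjoint U * U) * V"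
    using assms(1)[unfolded unitary_mat_def, THEN conjunct1] assms(2)[unfolded unitary_mat_def, THEN conjunct1]
    by (simp add: mat_adjoint_mult[of _ n n _ n] assoc_mult_mat[of _ n n _ n _ n] mult_carrier_mat[of _ n n _ n])
  then show "mat_adjoint (U * V) * (U * V) = 1\<^sub>m n"
    using assms right_mult_one_mat[of "mat_adjoint V" n n] by (simp add: unitary_mat_def)
qed

lemma scalar_prod_conjugate_self:
  "v \<bullet>c v = complex_of_real (\<Sum>i<dim_vec v. (cmod (v $ i))\<^sup>2)" for v :: "complex Matrix.vec"
  by (simp add: scalar_prod_def complex_norm_square lessThan_atLeast0 del: of_real_power)

text \<open>Gram-Schmidt on a basis that starts with \<open>v\<close> keeps its first vector.
  Dividing by the norms makes the columns orthonormal and turns the first one into a multiple of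
  \<open>v\<close>, which is still an eigenvector whenever \<open>v\<close> is.\<close>

lemma unitary_with_first_column:
  fixes v :: "complex Matrix.vec"
  assumes v: "v \<in> carrier_vec n" and v0: "v \<noteq> 0\<^sub>v n"
  obtains W r where "unitary_mat n W" "col W 0 = r \<cdot>\<^sub>v v" 
proof -
  interpret cof_vec_space n "TYPE(complex)" .
  define b where "b = basis_completion v"
  define ws where "ws = gram_schmidt n b"
  note b = basis_completion[OF v v0, folded b_def]
  have n: "n \<noteq> 0" using v v0 by auto
  have ws: "set ws \<subseteq> carrier_vec n" "corthogonal ws" "length ws = n"
    using gram_schmidt_result[OF b(2,4,5) refl, folded ws_def] b(6) by auto
  obtain vs where "b = v # vs" using b(6,7) n by (cases b) auto
  then have "hd ws = v" using gram_schmidt_hd[OF v] by (simp add: ws_def)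
  then have ws0: "ws ! 0 = v" using ws n by (cases ws) auto
  define r where "r w = complex_of_real (1 / sqrt (\<Sum>i<dim_vec w. (cmod (w $ i))\<^sup>2))" for w :: "complex Matrix.vec"
  have cnj_r: "cnj (r w) = r w" for w by (simp add: r_def)
  define W where "W = mat_of_cols n (map (\<lambda>w. r w \<cdot>\<^sub>v w) ws)"
  have W: "W \<in> carrier_mat n n" using ws by (auto simp: W_def)
  have wd: "dim_vec (ws ! i) = n" if "i < n" for i
    using that ws by (metis carrier_vecD nth_mem subsetD)
  have "mat_adjoint W * W = 1\<^sub>m n"
  proof (rule eq_matI)
    fix i j assume ij: "i < dim_row (1\<^sub>m n :: complex mat)" "j < dim_col (1\<^sub>m n :: complex mat)"
    then have i: "i < n" and j: "j < n" by auto
    have "(mat_adjoint W * W) $$ (i, j) = (\<Sum>k<n. cnj (r (ws!i) * (ws!i) $ k) * (r (ws!j) * (ws!j)$k))"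
      using i j W ws wd by (simp add: scalar_prod_def W_def mat_of_cols_index lessThan_atLeast0)
    also have "\<dots> = r (ws!i) * r (ws!j) * (ws!j \<bullet>c ws!i)"
      using i j wd by (simp add: scalar_prod_def sum_distrib_left conjugate_complex_def lessThan_atLeast0
          cnj_r mult_ac)
    also have "\<dots> = (if i = j then 1 else 0)"
    proof (cases "i = j")
      case True
      let ?s = "\<Sum>k<dim_vec (ws ! j). (cmod ((ws ! j) $ k))\<^sup>2"
      have "ws!j \<bullet>c ws!j \<noteq> 0" using corthogonalD[OF ws(2)] j ws(3) by auto
      then have "?s \<noteq> 0" unfolding scalar_prod_conjugate_self of_real_eq_0_iff .
      moreover have "?s \<ge> 0" by (simp add: sum_nonneg)
      ultimately have "r (ws!j) * r (ws!j) * (ws!j \<bullet>c ws!j) = 1"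
        unfolding scalar_prod_conjugate_self r_def of_real_mult[symmetric]
        by (simp add: divide_simps)
      then show ?thesis using True by simp
    next
      case False
      then show ?thesis using corthogonalD[OF ws(2)] i j ws(3) by auto
    qed
    finally show "(mat_adjoint W * W) $$ (i, j) = 1\<^sub>m n $$ (i, j)" using i j by simp
  qed (use W in auto)
  moreover have "col W 0 = r v \<cdot>\<^sub>v v"
    using ws ws0 n v by (simp add: W_def col_mat_of_cols)
  ultimately show ?thesis using that unitary_matI[OF W] by blast
qed

lemma hermitian_unitary_conj:
  assumes "A \<in> carrier_mat n n" "hermitian_mat A" "W \<in> carrier_mat n n"
  shows "hermitian_mat (mat_adjoint W * A * W)"
  using assms by (simp add: hermitian_mat_def mat_adjoint_mult[of _ n n _ n] assoc_mult_mat[of _ n n _ n _ n] mult_carrier_mat[of _ n n _ n])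

lemma char_poly_unitary_conj:
  assumes A: "A \<in> carrier_mat n n" and W: "unitary_mat n W"
  shows "char_poly (mat_adjoint W * A * W) = char_poly A"
proof (rule char_poly_similar)
  have "similar_mat_wit (mat_adjoint W * A * W) A (mat_adjoint W) W"
    using assms by (intro similar_mat_witI[of _ _ n]) (auto simp: unitary_mat_def)
  then show "similar_mat (mat_adjoint W * A * W) A" by (auto simp: similar_mat_def)
qed

text \<open>Deflation: in a unitary basis that starts with an eigenvector for \<open>e\<close>, the
  first column is \<open>e\<close> times a unit vector, and Hermitian symmetry clears the first row
  too. The remaining block is Hermitian with the remaining linear factors. The list
  \<open>es\<close> is a parameter so that the order of the eigenvalues on the diagonal can be
  prescribed.\<close>

theorem hermitian_diagonalization:
  assumes "A \<in> carrier_mat n n" "hermitian_mat A" "char_poly A = (\<Prod>e\<leftarrow>es. [:- e, 1:])"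
  shows "\<exists>U. unitary_mat n U \<and>
    mat_adjoint U * A * U = Matrix.mat n n (\<lambda>(i, j). if i = j then es ! i else 0)"
  using assms
proof (induction es arbitrary: n A)
  case Nil
  then have "n = 0" using degree_monic_char_poly[of A n] by simp
  then show ?case using Nil(1)
    by (intro exI[of _ "1\<^sub>m 0"]) (auto simp: unitary_mat_def intro!: eq_matI)
next
  case (Cons e es)
  note A = Cons.prems(1) and H = Cons.prems(2)
  have "eigenvalue A e" using Cons.prems(3) by (simp add: eigenvalue_root_char_poly[OF A])
  then obtain v where v: "v \<in> carrier_vec n" "v \<noteq> 0\<^sub>v n" "A *\<^sub>v v = e \<cdot>\<^sub>v v"
    using A by (auto simp: eigenvalue_def eigenvector_def)
  then obtain k where n: "n = Suc k" by (cases n) auto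
  obtain W r where W: "unitary_mat n W" "col W 0 = r \<cdot>\<^sub>v v"
    using unitary_with_first_column[OF v(1,2)] by blast
  have Wc: "W \<in> carrier_mat n n" and Wc': "mat_adjoint W \<in> carrier_mat n n" 
    using W by (auto simp: unitary_mat_def)
  have cW: "col W 0 \<in> carrier_vec n" using Wc by (metis carrier_matD(1) col_dim)
  define A' where "A' = mat_adjoint W * A * W"
  have A': "A' \<in> carrier_mat n n" using A Wc by (auto simp: A'_def)
  have H': "hermitian_mat A'" unfolding A'_def by (rule hermitian_unitary_conj[OF A H Wc])
  have "col A' 0 = e \<cdot>\<^sub>v (mat_adjoint W *\<^sub>v col W 0)"
  proof -
    have "col A' 0 = (mat_adjoint W * A) *\<^sub>v col W 0"
      unfolding A'_def using A Wc n by (intro col_mult2) auto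
    also have "\<dots> = mat_adjoint W *\<^sub>v (A *\<^sub>v col W 0)"
      using A Wc' cW by (intro assoc_mult_mat_vec[of _ n n _ n]) auto
    also have "A *\<^sub>v col W 0 = e \<cdot>\<^sub>v col W 0"
      using v A by (simp add: W(2) mult_mat_vec[of _ n n] smult_smult_assoc mult.commute)
    also have "mat_adjoint W *\<^sub>v (e \<cdot>\<^sub>v col W 0) = e \<cdot>\<^sub>v (mat_adjoint W *\<^sub>v col W 0)"
      using Wc' cW by (intro mult_mat_vec[of _ n n]) auto
    finally show ?thesis .
  qed
  also have "mat_adjoint W *\<^sub>v col W 0 = col (mat_adjoint W * W) 0"
    using Wc n by (intro col_mult2[symmetric]) auto
  also have "\<dots> = unit_vec n 0" using W n by (simp add: unitary_mat_def)
  finally have c0: "col A' 0 = e \<cdot>\<^sub>v unit_vec n 0" .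
  have A'col: "A' $$ (i, 0) = (if i = 0 then e else 0)" if "i < n" for i
    using arg_cong[OF c0, of "\<lambda>u. u $ i"] that A' n by auto
  have A'herm: "A' $$ (i, j) = cnj (A' $$ (j, i))" if "i < n" "j < n" for i j
    using arg_cong[OF H'[unfolded hermitian_mat_def], of "\<lambda>M. M $$ (i, j)"] that A' by auto
  have A'row: "A' $$ (0, j) = (if j = 0 then e else 0)" if "j < n" for j
    using A'herm[of 0 j] A'col[of j] A'col[of 0] that n by (cases "j = 0") auto
  define A3 where "A3 = Matrix.mat k k (\<lambda>(i, j). A' $$ (Suc i, Suc j))"
  have A3: "A3 \<in> carrier_mat k k" by (simp add: A3_def)
  define E where "E = Matrix.mat 1 1 (\<lambda>_. e)"
  have E: "E \<in> carrier_mat 1 1" by (simp add: E_def)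
  have blk: "A' = four_block_mat E (0\<^sub>m 1 k) (0\<^sub>m k 1) A3"
    using A' A'col A'row n
    by (intro eq_matI) (auto simp: A3_def E_def less_Suc_eq_0_disj)
  have "char_poly A' = char_poly E * char_poly A3"
    unfolding blk by (rule char_poly_four_block_zeros_col[OF E _ A3]) auto
  moreover have "char_poly E = [:- e, 1:]" by (simp add: E_def char_poly_defs det_def sign_def)
  moreover have "char_poly A' = char_poly A" unfolding A'_def by (rule char_poly_unitary_conj[OF A W(1)])
  ultimately have "[:- e, 1:] * char_poly A3 = [:- e, 1:] * (\<Prod>e\<leftarrow>es. [:- e, 1:])"
    using Cons.prems(3) by (simp only: list.map prod_list.Cons)
  then have cp3: "char_poly A3 = (\<Prod>e\<leftarrow>es. [:- e, 1:])"
    by (metis mult_cancel_left pCons_eq_0_iff zero_neq_one)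
  have "hermitian_mat A3" unfolding hermitian_mat_def
  proof (rule eq_matI)
    fix i j assume "i < dim_row A3" "j < dim_col A3"
    then show "mat_adjoint A3 $$ (i, j) = A3 $$ (i, j)"
      using A'herm[of "Suc i" "Suc j"] n by (simp add: A3_def)
  qed (auto simp: A3_def)
  from Cons.IH[OF A3 this cp3] obtain U where U: "unitary_mat k U"
    "mat_adjoint U * A3 * U = Matrix.mat k k (\<lambda>(i, j). if i = j then es ! i else 0)" by blast
  have Uc: "U \<in> carrier_mat k k" using U by (simp add: unitary_mat_def)
  define V where "V = four_block_mat (1\<^sub>m 1) (0\<^sub>m 1 k) (0\<^sub>m k 1) U"
  have V: "V \<in> carrier_mat n n" using Uc n by (auto simp: V_def)
  have V': "mat_adjoint V = four_block_mat (1\<^sub>m 1) (0\<^sub>m 1 k) (0\<^sub>m k 1) (mat_adjoint U)"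
    using Uc by (intro eq_matI) (auto simp: V_def)
  have uV: "unitary_mat n V"
  proof (rule unitary_matI[OF V])
    have "mat_adjoint V * V = four_block_mat (1\<^sub>m 1) (0\<^sub>m 1 k) (0\<^sub>m k 1) (1\<^sub>m k)"
      unfolding V' unfolding V_def using U Uc
      by (subst mult_four_block_mat[of _ 1 1 _ k _ k _ _ 1 _ k]) (auto simp: unitary_mat_def)
    then show "mat_adjoint V * V = 1\<^sub>m n" using n by (auto intro!: eq_matI)
  qed
  have UA: "mat_adjoint U * A3 \<in> carrier_mat k k" "mat_adjoint U * A3 * U \<in> carrier_mat k k"
    using Uc A3 by (auto intro: mult_carrier_mat[of _ k k])
  have "mat_adjoint V * A' * V = four_block_mat E (0\<^sub>m 1 k) (0\<^sub>m k 1) (mat_adjoint U * A3 * U)"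
    unfolding V' blk unfolding V_def using U(1) Uc E A3 UA
    by (simp add: mult_four_block_mat[of _ 1 1 _ k _ k _ _ 1 _ k])
  also have "\<dots> = Matrix.mat n n (\<lambda>(i, j). if i = j then (e # es) ! i else 0)"
    unfolding U(2) using n by (intro eq_matI) (auto simp: E_def nth_Cons')
  finally have "mat_adjoint V * A' * V = Matrix.mat n n (\<lambda>(i, j). if i = j then (e # es) ! i else 0)" .
  moreover have "mat_adjoint (W * V) * A * (W * V) = mat_adjoint V * A' * V"
    using A Wc V Wc' mat_adjoint_carrier[OF V] unfolding A'_def mat_adjoint_mult[OF Wc V]
    by (simp add: assoc_mult_mat[of _ n n _ n _ n] mult_carrier_mat[of _ n n _ n])
  ultimately show ?case using unitary_mat_mult[OF W(1) uV] by (intro exI[of _ "W * V"]) simp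
qed

lemma proots_linear_factors: "proots (\<Prod>e\<leftarrow>es. [:- e, 1:]) = mset es" for es :: "complex list"
proof (induction es)
  case (Cons e es)
  have "(\<Prod>e\<leftarrow>es. [:- e, 1:]) \<noteq> 0" by (auto simp: prod_list_zero_iff)
  then have "proots ([:- e, 1:] * (\<Prod>e\<leftarrow>es. [:- e, 1:])) = mset (e # es)"
    using Cons by (subst proots_mult) auto
  then show ?case by simp
qed simp

lemma spec_eqI:
  assumes "char_poly M = (\<Prod>e\<leftarrow>map complex_of_real s. [:- e, 1:])" "sorted (rev s)"
  shows "spec M = s"
proof -
  have "image_mset Re (proots (char_poly M)) = mset s"
    unfolding assms(1) proots_linear_factors by (simp flip: mset_map add: o_def)
  moreover have "sort s = rev s" using assms(2) by (intro properties_for_sort) auto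
  ultimately show ?thesis by (simp add: spec_def)
qed

lemma spec_diagonal:
  assumes "length s = n" "sorted (rev s)"
  shows "spec (Matrix.mat n n (\<lambda>(i, j). if i = j then complex_of_real (s ! i) else 0)) = s" (is "spec ?M = s")
proof (rule spec_eqI)
  have "diag_mat ?M = map complex_of_real s"
    using assms(1) by (intro nth_equalityI) (auto simp: diag_mat_def)
  then show "char_poly ?M = (\<Prod>e\<leftarrow>map complex_of_real s. [:- e, 1:])"
    by (subst char_poly_upper_triangular[of _ n]) auto
qed fact

text \<open>Two passes are made, because \<open>spec\<close> sorts real parts and the roots have to
  be known to be real first. Diagonalizing in an arbitrary order exhibits them as diagonal entries
  of a Hermitian matrix; the second pass uses the order of \<open>spec M\<close>.\<close>

lemma hermitian_diagonalization_spec: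
  assumes M: "M \<in> carrier_mat n n" "hermitian_mat M"
  obtains U where "unitary_mat n U"
    "mat_adjoint U * M * U = Matrix.mat n n (\<lambda>(i, j). if i = j then complex_of_real (spec M ! i) else 0)"
proof -
  obtain es where es: "char_poly M = (\<Prod>e\<leftarrow>es. [:- e, 1:])" "length es = n"
    using char_poly_factorized[OF M(1)] by blast
  obtain U where U: "unitary_mat n U"
    "mat_adjoint U * M * U = Matrix.mat n n (\<lambda>(i, j). if i = j then es ! i else 0)" (is "?D = ?E")
    using hermitian_diagonalization[OF M es(1)] by blast
  have "hermitian_mat ?D"
    using U(1) by (intro hermitian_unitary_conj[OF M]) (simp add: unitary_mat_def)
  then have herm: "mat_adjoint ?E = ?E" unfolding U(2) hermitian_mat_def .
  have real: "complex_of_real (Re e) = e" if e: "e \<in> set es" for e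
  proof -
    obtain i where i: "i < n" "e = es ! i" using e es(2) by (auto simp: in_set_conv_nth)
    have "cnj (es ! i) = es ! i" using arg_cong[OF herm, of "\<lambda>M. M $$ (i, i)"] i by simp
    then show ?thesis using i by (simp add: complex_eq_iff)
  qed
  have "mset (map complex_of_real (spec M)) = mset (map complex_of_real (map Re es))"
    unfolding mset_map by (simp add: spec_def es(1) proots_linear_factors)
  also have "map complex_of_real (map Re es) = es" using real by (simp add: map_idI)
  finally have "mset (map (\<lambda>e. [:- e, 1:]) (map complex_of_real (spec M))) = mset (map (\<lambda>e. [:- e, 1:]) es)"
    by (simp only: mset_map)
  then have "char_poly M = (\<Prod>e\<leftarrow>map complex_of_real (spec M). [:- e, 1:])"
    unfolding es(1) by (metis prod_mset_prod_list)
  from hermitian_diagonalization[OF M this] obtain U where U: "unitary_mat n U"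
    "mat_adjoint U * M * U = Matrix.mat n n (\<lambda>(i, j). if i = j then map complex_of_real (spec M) ! i else 0)"
    by blast
  have "mset (spec M) = mset (map Re es)" by (simp add: spec_def es(1) proots_linear_factors)
  then have "length (spec M) = n" using es(2) mset_eq_length by fastforce
  then have "Matrix.mat n n (\<lambda>(i, j). if i = j then map complex_of_real (spec M) ! i else 0) =
      Matrix.mat n n (\<lambda>(i, j). if i = j then complex_of_real (spec M ! i) else 0)"
    by (intro cong_mat) auto
  then show ?thesis using U that by simp
qed

section \<open>Quadratic forms of Gram matrices in a unitary basis\<close>

lemma sum_swap3:
  "(\<Sum>x\<in>X. \<Sum>i\<in>I. \<Sum>j\<in>J. f x i j) = (\<Sum>i\<in>I. \<Sum>j\<in>J. \<Sum>x\<in>X. f x i j)"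
proof -
  have "(\<Sum>x\<in>X. \<Sum>i\<in>I. \<Sum>j\<in>J. f x i j) = (\<Sum>i\<in>I. \<Sum>x\<in>X. \<Sum>j\<in>J. f x i j)"
    by (rule sum.swap)
  also have "\<dots> = (\<Sum>i\<in>I. \<Sum>j\<in>J. \<Sum>x\<in>X. f x i j)"
    by (intro sum.cong refl sum.swap)
  finally show ?thesis .
qed

lemma cmod_sum_square:
  "complex_of_real ((cmod (\<Sum>p\<in>P. a p))\<^sup>2) = (\<Sum>p\<in>P. \<Sum>q\<in>P. cnj (a p) * a q)"
  unfolding complex_norm_square by (subst mult.commute) (simp only: cnj_sum sum_product)

lemma unitary_isometry:
  assumes U: "unitary_mat n U"
  shows "(\<Sum>p<n. (cmod (\<Sum>i<n. U $$ (i, p) * h i))\<^sup>2) = (\<Sum>i<n. (cmod (h i))\<^sup>2)"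
proof -
  have orth: "(\<Sum>p<n. cnj (U $$ (i, p)) * U $$ (j, p)) = (if i = j then 1 else 0)"
    if "i < n" "j < n" for i j
  proof -
    have c: "U \<in> carrier_mat n n" "U * mat_adjoint U = 1\<^sub>m n" using U by (auto simp: unitary_mat_def)
    show ?thesis using arg_cong[OF c(2), of "\<lambda>M. M $$ (j, i)"] c(1) that
      by (auto simp: scalar_prod_def lessThan_atLeast0 mult.commute)
  qed
  have "complex_of_real (\<Sum>p<n. (cmod (\<Sum>i<n. U $$ (i, p) * h i))\<^sup>2) =
      (\<Sum>p<n. \<Sum>i<n. \<Sum>j<n. cnj (U $$ (i, p) * h i) * (U $$ (j, p) * h j))"
    by (simp only: of_real_sum cmod_sum_square)
  also have "\<dots> = (\<Sum>i<n. \<Sum>j<n. \<Sum>p<n. cnj (U $$ (i, p) * h i) * (U $$ (j, p) * h j))"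
    by (rule sum_swap3)
  also have "\<dots> = (\<Sum>i<n. \<Sum>j<n. cnj (h i) * h j * (\<Sum>p<n. cnj (U $$ (i, p)) * U $$ (j, p)))"
    by (simp add: sum_distrib_left mult_ac)
  also have "\<dots> = (\<Sum>i<n. \<Sum>j<n. if i = j then cnj (h i) * h j else 0)"
    by (intro sum.cong refl) (simp add: orth)
  also have "\<dots> = complex_of_real (\<Sum>i<n. (cmod (h i))\<^sup>2)"
    by (simp add: complex_norm_square mult.commute del: of_real_power)
  finally show ?thesis by (simp only: of_real_eq_iff)
qed

lemma unitary_isometry2:
  assumes U: "unitary_mat b U" and V: "unitary_mat c V"
  shows "(\<Sum>q<b. \<Sum>r<c. (cmod (\<Sum>j<b. \<Sum>k<c. U $$ (j, q) * V $$ (k, r) * h j k))\<^sup>2) =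
    (\<Sum>j<b. \<Sum>k<c. (cmod (h j k))\<^sup>2)"
proof -
  have "(\<Sum>q<b. \<Sum>r<c. (cmod (\<Sum>j<b. \<Sum>k<c. U $$ (j, q) * V $$ (k, r) * h j k))\<^sup>2) =
      (\<Sum>r<c. \<Sum>q<b. (cmod (\<Sum>j<b. U $$ (j, q) * (\<Sum>k<c. V $$ (k, r) * h j k)))\<^sup>2)"
    by (subst sum.swap) (simp add: sum_distrib_left mult.assoc)
  also have "\<dots> = (\<Sum>j<b. \<Sum>r<c. (cmod (\<Sum>k<c. V $$ (k, r) * h j k))\<^sup>2)"
    unfolding unitary_isometry[OF U] by (rule sum.swap)
  finally show ?thesis unfolding unitary_isometry[OF V] .
qed

text \<open>\<open>G\<close> is a scaled Gram matrix of the vectors \<open>f i\<close>. Their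
  combinations with the columns of \<open>U\<close> are orthogonal, and the scaled squared norms are
  the eigenvalues. A quadratic form in \<open>w\<close> records norms and orthogonality in one
  identity; the abstract index set \<open>X\<close> lets one lemma serve all three
  flattenings.\<close>

lemma gram_diagonalization:
  fixes f :: "nat \<Rightarrow> 'x \<Rightarrow> complex"
  assumes G: "G \<in> carrier_mat n n"
    and f: "\<And>i j. i < n \<Longrightarrow> j < n \<Longrightarrow>
      G $$ (i, j) = complex_of_real s * (\<Sum>x\<in>X. cnj (f i x) * f j x)"
  obtains U where "unitary_mat n U"
    "\<And>w. s * (\<Sum>x\<in>X. (cmod (\<Sum>p<n. w p * (\<Sum>i<n. U $$ (i, p) * f i x)))\<^sup>2) =
      (\<Sum>p<n. spec G ! p * (cmod (w p))\<^sup>2)"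
proof -
  have "hermitian_mat G" unfolding hermitian_mat_def
    using G by (intro eq_matI) (auto simp: f mult.commute)
  then obtain U where U: "unitary_mat n U" and
    D: "mat_adjoint U * G * U = Matrix.mat n n (\<lambda>(i, j). if i = j then complex_of_real (spec G ! i) else 0)"
    using hermitian_diagonalization_spec[OF G] by blast
  have Uc: "U \<in> carrier_mat n n" using U by (simp add: unitary_mat_def)
  define g where "g p x = (\<Sum>i<n. U $$ (i, p) * f i x)" for p x
  have gram: "complex_of_real s * (\<Sum>x\<in>X. cnj (g p x) * g q x) =
      (if p = q then complex_of_real (spec G ! p) else 0)" if p: "p < n" and q: "q < n" for p q
  proof -
    have "complex_of_real s * (\<Sum>x\<in>X. cnj (g p x) * g q x) =
        complex_of_real s * (\<Sum>x\<in>X. \<Sum>i<n. \<Sum>j<n. cnj (U $$ (i, p) * f i x) * (U $$ (j, q) * f j x))"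
      unfolding g_def cnj_sum sum_product ..
    also have "(\<Sum>x\<in>X. \<Sum>i<n. \<Sum>j<n. cnj (U $$ (i, p) * f i x) * (U $$ (j, q) * f j x)) =
        (\<Sum>i<n. \<Sum>j<n. \<Sum>x\<in>X. cnj (U $$ (i, p) * f i x) * (U $$ (j, q) * f j x))"
      by (rule sum_swap3)
    also have "complex_of_real s * \<dots> = (\<Sum>i<n. \<Sum>j<n. cnj (U $$ (i, p)) * G $$ (i, j) * U $$ (j, q))"
      unfolding sum_distrib_left by (intro sum.cong refl) (simp add: f sum_distrib_left sum_distrib_right mult_ac)
    also have "\<dots> = (\<Sum>j<n. (\<Sum>i<n. cnj (U $$ (i, p)) * G $$ (i, j)) * U $$ (j, q))"
      by (subst sum.swap) (simp add: sum_distrib_right)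
    also have "\<dots> = (mat_adjoint U * G * U) $$ (p, q)"
      using Uc G p q by (simp add: scalar_prod_def lessThan_atLeast0)
    finally show ?thesis using p q by (simp add: D)
  qed
  have "s * (\<Sum>x\<in>X. (cmod (\<Sum>p<n. w p * g p x))\<^sup>2) = (\<Sum>p<n. spec G ! p * (cmod (w p))\<^sup>2)" for w
  proof -
    have "complex_of_real (s * (\<Sum>x\<in>X. (cmod (\<Sum>p<n. w p * g p x))\<^sup>2)) =
        complex_of_real s * (\<Sum>x\<in>X. \<Sum>p<n. \<Sum>q<n. cnj (w p * g p x) * (w q * g q x))"
      by (simp only: of_real_mult of_real_sum cmod_sum_square)
    also have "(\<Sum>x\<in>X. \<Sum>p<n. \<Sum>q<n. cnj (w p * g p x) * (w q * g q x)) =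
        (\<Sum>p<n. \<Sum>q<n. \<Sum>x\<in>X. cnj (w p * g p x) * (w q * g q x))"
      by (rule sum_swap3)
    also have "complex_of_real s * \<dots> =
        (\<Sum>p<n. \<Sum>q<n. cnj (w p) * w q * (complex_of_real s * (\<Sum>x\<in>X. cnj (g p x) * g q x)))"
      by (simp add: sum_distrib_left mult_ac)
    also have "\<dots> = (\<Sum>p<n. \<Sum>q<n. if p = q then cnj (w p) * w q * complex_of_real (spec G ! p) else 0)"
      by (intro sum.cong refl) (simp add: gram)
    also have "\<dots> = complex_of_real (\<Sum>p<n. spec G ! p * (cmod (w p))\<^sup>2)"
      by (simp add: complex_norm_square mult_ac del: of_real_power)
    finally show ?thesis by (simp only: of_real_eq_iff)
  qed
  then show ?thesis using U that unfolding g_def by blast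
qed

lemma nat_index_less: "j < b \<Longrightarrow> k < c \<Longrightarrow> j * c + k < b * c" for b c j k :: nat
  by (metis add_less_cancel_left add_mult_distrib less_le_trans mult_1 mult_le_mono1 Suc_eq_plus1 Suc_leI)

text \<open>Translates the single row index of a flattening into a pair of tensor indices.\<close>

lemma sum_div_mod:
  fixes g :: "nat \<Rightarrow> nat \<Rightarrow> 'a :: comm_monoid_add"
  shows "(\<Sum>r<b * c. g (r div c) (r mod c)) = (\<Sum>j<b. \<Sum>k<c. g j k)"
proof (cases "c = 0")
  case False
  then show ?thesis
    unfolding sum.cartesian_product
    by (intro sum.reindex_bij_witness[where i = "\<lambda>(j, k). j * c + k" and j = "\<lambda>r. (r div c, r mod c)"])
      (auto simp: less_mult_imp_div_less nat_index_less)
qed simp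

section \<open>Moment matrices and the group action\<close>

lemma index_moment1:
  assumes "i < a" "i' < a"
  shows "moment1 a b c T $$ (i, i') = complex_of_real (1 / (tensor_norm a b c T)\<^sup>2) *
    (\<Sum>j<b. \<Sum>k<c. cnj (T i j k) * T i' j k)"
  using assms sum_div_mod[of "\<lambda>j k. cnj (T i j k) * T i' j k" c b]
  by (simp add: moment1_def flat1_def scalar_prod_def lessThan_atLeast0)

lemma index_moment2:
  assumes "j < b" "j' < b"
  shows "moment2 a b c T $$ (j, j') = complex_of_real (1 / (tensor_norm a b c T)\<^sup>2) *
    (\<Sum>i<a. \<Sum>k<c. cnj (T i j k) * T i j' k)"
  using assms sum_div_mod[of "\<lambda>i k. cnj (T i j k) * T i j' k" c a]
  by (simp add: moment2_def flat2_def scalar_prod_def lessThan_atLeast0)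

lemma index_moment3:
  assumes "k < c" "k' < c"
  shows "moment3 a b c T $$ (k, k') = complex_of_real (1 / (tensor_norm a b c T)\<^sup>2) *
    (\<Sum>i<a. \<Sum>j<b. cnj (T i j k) * T i j k')"
  using assms sum_div_mod[of "\<lambda>i j. cnj (T i j k) * T i j k'" b a]
  by (simp add: moment3_def flat3_def scalar_prod_def lessThan_atLeast0)

lemma moment_carrier:
  "moment1 a b c T \<in> carrier_mat a a" "moment2 a b c T \<in> carrier_mat b b"
  "moment3 a b c T \<in> carrier_mat c c"
  by (auto simp: moment1_def moment2_def moment3_def flat1_def flat2_def flat3_def)

lemma GL_I:
  assumes "A \<in> carrier_mat n n" "B \<in> carrier_mat n n" "A * B = 1\<^sub>m n"
  shows "A \<in> GL n"
  using assms mat_mult_left_right_inverse[OF assms]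
  by (auto simp: GL_def invertible_mat_def inverts_mat_def square_mat.simps)

lemma GL_E:
  assumes "A \<in> GL n"
  obtains B where "A \<in> carrier_mat n n" "B \<in> carrier_mat n n" "A * B = 1\<^sub>m n" "B * A = 1\<^sub>m n"
proof -
  obtain B where A: "A \<in> carrier_mat n n" and B: "A * B = 1\<^sub>m n" "B * A = 1\<^sub>m (dim_row B)"
    using assms by (auto simp: GL_def invertible_mat_def inverts_mat_def)
  have "dim_col B = n" "dim_row B = n"
    using arg_cong[OF B(1), of dim_col] arg_cong[OF B(2), of dim_col] A by auto
  then show ?thesis using that[of B] A B by auto
qed

lemma GL_mult:
  assumes "A \<in> GL n" "B \<in> GL n"
  shows "A * B \<in> GL n"
proof -
  obtain A' where A: "A \<in> carrier_mat n n" "A' \<in> carrier_mat n n" "A * A' = 1\<^sub>m n"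
    using assms(1) by (rule GL_E)
  obtain B' where B: "B \<in> carrier_mat n n" "B' \<in> carrier_mat n n" "B * B' = 1\<^sub>m n"
    using assms(2) by (rule GL_E)
  have "A * B * (B' * A') = A * (B * B') * A'"
    using A(1,2) B(1,2) by (simp add: assoc_mult_mat[of _ n n _ n _ n] mult_carrier_mat[of _ n n _ n])
  also have "\<dots> = 1\<^sub>m n" using A B by simp
  finally show ?thesis using A B by (intro GL_I[of _ _ "B' * A'"]) auto
qed

lemma GL_transpose_unitary:
  assumes "unitary_mat n U"
  shows "transpose_mat U \<in> GL n"
proof (rule GL_I)
  have U: "U \<in> carrier_mat n n" "mat_adjoint U * U = 1\<^sub>m n" using assms by (auto simp: unitary_mat_def)
  show "transpose_mat U * transpose_mat (mat_adjoint U) = 1\<^sub>m n"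
    using U transpose_mult[of "mat_adjoint U" n n U n] by simp
qed (use assms in \<open>auto simp: unitary_mat_def\<close>)

lemma sum_linear_combination:
  fixes w :: "nat \<Rightarrow> 'a :: comm_semiring_0"
  shows "(\<Sum>p\<in>P. w p * (\<Sum>j\<in>J. \<Sum>k\<in>K. u j k * g p j k)) =
    (\<Sum>j\<in>J. \<Sum>k\<in>K. u j k * (\<Sum>p\<in>P. w p * g p j k))"
proof -
  have "(\<Sum>p\<in>P. w p * (\<Sum>j\<in>J. \<Sum>k\<in>K. u j k * g p j k)) =
      (\<Sum>p\<in>P. \<Sum>j\<in>J. \<Sum>k\<in>K. u j k * (w p * g p j k))"
    by (simp add: sum_distrib_left mult.left_commute)
  also have "\<dots> = (\<Sum>j\<in>J. \<Sum>k\<in>K. \<Sum>p\<in>P. u j k * (w p * g p j k))" by (rule sum_swap3)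
  finally show ?thesis by (simp add: sum_distrib_left)
qed

text \<open>Each flattening has its own diagonalizing unitary matrix. The other two act as
  isometries on the remaining indices and leave its quadratic form unchanged, so all three can be
  applied at once. The matrices found are transposes, since \<open>tensor_act\<close> sums over the
  column index and \<open>gram_diagonalization\<close> over the row index.\<close>

lemma moment_normal_form:
  obtains A B C where "A \<in> GL a" "B \<in> GL b" "C \<in> GL c"
    "\<And>w. (\<Sum>j<b. \<Sum>k<c. (cmod (\<Sum>i<a. w i * tensor_act a b c A B C S i j k))\<^sup>2) / (tensor_norm a b c S)\<^sup>2 =
      (\<Sum>i<a. spec (moment1 a b c S) ! i * (cmod (w i))\<^sup>2)"
    "\<And>w. (\<Sum>i<a. \<Sum>k<c. (cmod (\<Sum>j<b. w j * tensor_act a b c A B C S i j k))\<^sup>2) / (tensor_norm a b c S)\<^sup>2 =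
      (\<Sum>j<b. spec (moment2 a b c S) ! j * (cmod (w j))\<^sup>2)"
    "\<And>w. (\<Sum>i<a. \<Sum>j<b. (cmod (\<Sum>k<c. w k * tensor_act a b c A B C S i j k))\<^sup>2) / (tensor_norm a b c S)\<^sup>2 =
      (\<Sum>k<c. spec (moment3 a b c S) ! k * (cmod (w k))\<^sup>2)"
proof -
  let ?s = "1 / (tensor_norm a b c S)\<^sup>2"
  obtain U where U: "unitary_mat a U" and
    wU: "\<And>w. ?s * (\<Sum>(j, k)\<in>{..<b} \<times> {..<c}. (cmod (\<Sum>p<a. w p * (\<Sum>i<a. U $$ (i, p) * S i j k)))\<^sup>2) =
      (\<Sum>p<a. spec (moment1 a b c S) ! p * (cmod (w p))\<^sup>2)"
    using gram_diagonalization[OF moment_carrier(1)[of a b c S],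
        where s = ?s and X = "{..<b} \<times> {..<c}" and f = "\<lambda>i (j, k). S i j k"]
    by (auto simp: index_moment1 sum.cartesian_product split_def)
  obtain V where V: "unitary_mat b V" and
    wV: "\<And>w. ?s * (\<Sum>(i, k)\<in>{..<a} \<times> {..<c}. (cmod (\<Sum>p<b. w p * (\<Sum>j<b. V $$ (j, p) * S i j k)))\<^sup>2) =
      (\<Sum>p<b. spec (moment2 a b c S) ! p * (cmod (w p))\<^sup>2)"
    using gram_diagonalization[OF moment_carrier(2)[of a b c S],
        where s = ?s and X = "{..<a} \<times> {..<c}" and f = "\<lambda>j (i, k). S i j k"]
    by (auto simp: index_moment2 sum.cartesian_product split_def)
  obtain W where W: "unitary_mat c W" and
    wW: "\<And>w. ?s * (\<Sum>(i, j)\<in>{..<a} \<times> {..<b}. (cmod (\<Sum>p<c. w p * (\<Sum>k<c. W $$ (k, p) * S i j k)))\<^sup>2) =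
      (\<Sum>p<c. spec (moment3 a b c S) ! p * (cmod (w p))\<^sup>2)"
    using gram_diagonalization[OF moment_carrier(3)[of a b c S],
        where s = ?s and X = "{..<a} \<times> {..<b}" and f = "\<lambda>k (i, j). S i j k"]
    by (auto simp: index_moment3 sum.cartesian_product split_def)
  let ?R = "tensor_act a b c (transpose_mat U) (transpose_mat V) (transpose_mat W) S"
  have c: "U \<in> carrier_mat a a" "V \<in> carrier_mat b b" "W \<in> carrier_mat c c"
    using U V W by (auto simp: unitary_mat_def)
  have R: "?R p q r = (\<Sum>i<a. \<Sum>j<b. \<Sum>k<c. U $$ (i, p) * V $$ (j, q) * W $$ (k, r) * S i j k)"
    if "p < a" "q < b" "r < c" for p q r
    using that c by (simp add: tensor_act_def)
  have R1: "?R p q r = (\<Sum>j<b. \<Sum>k<c. V $$ (j, q) * W $$ (k, r) * (\<Sum>i<a. U $$ (i, p) * S i j k))"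
    if "p < a" "q < b" "r < c" for p q r
    unfolding R[OF that] sum_distrib_left by (subst sum_swap3) (simp add: mult_ac)
  have R2: "?R p q r = (\<Sum>i<a. \<Sum>k<c. U $$ (i, p) * W $$ (k, r) * (\<Sum>j<b. V $$ (j, q) * S i j k))"
    if "p < a" "q < b" "r < c" for p q r
    unfolding R[OF that] sum_distrib_left by (rule sum.cong[OF refl], subst sum.swap) (simp add: mult_ac)
  have R3: "?R p q r = (\<Sum>i<a. \<Sum>j<b. U $$ (i, p) * V $$ (j, q) * (\<Sum>k<c. W $$ (k, r) * S i j k))"
    if "p < a" "q < b" "r < c" for p q r
    unfolding R[OF that] sum_distrib_left by (simp add: mult_ac)
  show ?thesis
  proof (rule that[of "transpose_mat U" "transpose_mat V" "transpose_mat W"])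
    fix w :: "nat \<Rightarrow> complex"
    have "(\<Sum>j<b. \<Sum>k<c. (cmod (\<Sum>i<a. w i * ?R i j k))\<^sup>2) =
        (\<Sum>j<b. \<Sum>k<c. (cmod (\<Sum>p<a. w p * (\<Sum>i<a. U $$ (i, p) * S i j k)))\<^sup>2)"
      by (simp add: R1 sum_linear_combination unitary_isometry2[OF V W])
    then show "(\<Sum>j<b. \<Sum>k<c. (cmod (\<Sum>i<a. w i * ?R i j k))\<^sup>2) / (tensor_norm a b c S)\<^sup>2 =
        (\<Sum>i<a. spec (moment1 a b c S) ! i * (cmod (w i))\<^sup>2)"
      using wU[of w] by (simp add: sum.cartesian_product)
    have "(\<Sum>i<a. \<Sum>k<c. (cmod (\<Sum>j<b. w j * ?R i j k))\<^sup>2) =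
        (\<Sum>i<a. \<Sum>k<c. (cmod (\<Sum>p<b. w p * (\<Sum>j<b. V $$ (j, p) * S i j k)))\<^sup>2)"
      by (simp add: R2 sum_linear_combination unitary_isometry2[OF U W])
    then show "(\<Sum>i<a. \<Sum>k<c. (cmod (\<Sum>j<b. w j * ?R i j k))\<^sup>2) / (tensor_norm a b c S)\<^sup>2 =
        (\<Sum>j<b. spec (moment2 a b c S) ! j * (cmod (w j))\<^sup>2)"
      using wV[of w] by (simp add: sum.cartesian_product)
    have "(\<Sum>i<a. \<Sum>j<b. (cmod (\<Sum>k<c. w k * ?R i j k))\<^sup>2) =
        (\<Sum>i<a. \<Sum>j<b. (cmod (\<Sum>p<c. w p * (\<Sum>k<c. W $$ (k, p) * S i j k)))\<^sup>2)"
      by (simp add: R3 sum_linear_combination unitary_isometry2[OF U V])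
    then show "(\<Sum>i<a. \<Sum>j<b. (cmod (\<Sum>k<c. w k * ?R i j k))\<^sup>2) / (tensor_norm a b c S)\<^sup>2 =
        (\<Sum>k<c. spec (moment3 a b c S) ! k * (cmod (w k))\<^sup>2)"
      using wW[of w] by (simp add: sum.cartesian_product)
  qed (use GL_transpose_unitary U V W in auto)
qed

section \<open>Composition of actions and orbit closures\<close>

lemma sum_swap4:
  "(\<Sum>x\<in>X. \<Sum>i\<in>I. \<Sum>j\<in>J. \<Sum>k\<in>K. f x i j k) = (\<Sum>i\<in>I. \<Sum>j\<in>J. \<Sum>k\<in>K. \<Sum>x\<in>X. f x i j k)"
proof -
  have "(\<Sum>x\<in>X. \<Sum>i\<in>I. \<Sum>j\<in>J. \<Sum>k\<in>K. f x i j k) = (\<Sum>i\<in>I. \<Sum>x\<in>X. \<Sum>j\<in>J. \<Sum>k\<in>K. f x i j k)"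
    by (rule sum.swap)
  also have "\<dots> = (\<Sum>i\<in>I. \<Sum>j\<in>J. \<Sum>k\<in>K. \<Sum>x\<in>X. f x i j k)"
    by (rule sum.cong[OF refl]) (rule sum_swap3)
  finally show ?thesis .
qed

lemma sum_swap33:
  "(\<Sum>i\<in>I. \<Sum>j\<in>J. \<Sum>k\<in>K. \<Sum>p\<in>P. \<Sum>q\<in>Q. \<Sum>r\<in>R. f i j k p q r) =
    (\<Sum>p\<in>P. \<Sum>q\<in>Q. \<Sum>r\<in>R. \<Sum>i\<in>I. \<Sum>j\<in>J. \<Sum>k\<in>K. f i j k p q r)"
proof -
  have "(\<Sum>i\<in>I. \<Sum>j\<in>J. \<Sum>k\<in>K. \<Sum>p\<in>P. \<Sum>q\<in>Q. \<Sum>r\<in>R. f i j k p q r) =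
      (\<Sum>i\<in>I. \<Sum>j\<in>J. \<Sum>p\<in>P. \<Sum>q\<in>Q. \<Sum>r\<in>R. \<Sum>k\<in>K. f i j k p q r)"
    by (rule sum.cong[OF refl], rule sum.cong[OF refl], rule sum_swap4)
  also have "\<dots> = (\<Sum>i\<in>I. \<Sum>p\<in>P. \<Sum>q\<in>Q. \<Sum>r\<in>R. \<Sum>j\<in>J. \<Sum>k\<in>K. f i j k p q r)"
    by (rule sum.cong[OF refl], rule sum_swap4)
  also have "\<dots> = (\<Sum>p\<in>P. \<Sum>q\<in>Q. \<Sum>r\<in>R. \<Sum>i\<in>I. \<Sum>j\<in>J. \<Sum>k\<in>K. f i j k p q r)"
    by (rule sum_swap4)
  finally show ?thesis .
qed

lemma prod3_sum:
  fixes f :: "_ \<Rightarrow> 'a :: comm_semiring_0"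
  shows "(\<Sum>i\<in>I. f i) * (\<Sum>j\<in>J. g j) * (\<Sum>k\<in>K. h k) * t = (\<Sum>i\<in>I. \<Sum>j\<in>J. \<Sum>k\<in>K. f i * g j * h k * t)"
proof -
  have "(\<Sum>i\<in>I. f i) * (\<Sum>j\<in>J. g j) * (\<Sum>k\<in>K. h k) * t =
      (\<Sum>i\<in>I. \<Sum>j\<in>J. f i * g j) * ((\<Sum>k\<in>K. h k) * t)"
    by (simp only: sum_product[of f I g J, symmetric] mult.assoc)
  also have "\<dots> = (\<Sum>i\<in>I. \<Sum>j\<in>J. f i * g j * ((\<Sum>k\<in>K. h k) * t))"
    by (simp only: sum_distrib_right[of _ _ "sum h K * t"])
  finally show ?thesis by (simp only: sum_distrib_left sum_distrib_right mult.assoc)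
qed

lemma tensor_act_act:
  assumes A: "A \<in> carrier_mat a a" "A' \<in> carrier_mat a a"
    and B: "B \<in> carrier_mat b b" "B' \<in> carrier_mat b b"
    and C: "C \<in> carrier_mat c c" "C' \<in> carrier_mat c c"
  shows "tensor_act a b c A B C (tensor_act a b c A' B' C' T) = tensor_act a b c (A * A') (B * B') (C * C') T"
proof (intro ext)
  fix i j k
  show "tensor_act a b c A B C (tensor_act a b c A' B' C' T) i j k =
    tensor_act a b c (A * A') (B * B') (C * C') T i j k"
  proof (cases "i < a \<and> j < b \<and> k < c")
    case True
    let ?F = "\<lambda>i' j' k' p q r. A $$ (i, i') * B $$ (j, j') * C $$ (k, k') *
      (A' $$ (i', p) * B' $$ (j', q) * C' $$ (k', r) * T p q r)"
    have "tensor_act a b c A B C (tensor_act a b c A' B' C' T) i j k =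
        (\<Sum>i'<a. \<Sum>j'<b. \<Sum>k'<c. \<Sum>p<a. \<Sum>q<b. \<Sum>r<c. ?F i' j' k' p q r)"
      using True by (simp add: tensor_act_def sum_distrib_left)
    also have "\<dots> = (\<Sum>p<a. \<Sum>q<b. \<Sum>r<c. \<Sum>i'<a. \<Sum>j'<b. \<Sum>k'<c. ?F i' j' k' p q r)"
      by (rule sum_swap33)
    also have "\<dots> = (\<Sum>p<a. \<Sum>q<b. \<Sum>r<c.
        (\<Sum>i'<a. A $$ (i, i') * A' $$ (i', p)) * (\<Sum>j'<b. B $$ (j, j') * B' $$ (j', q)) *
        (\<Sum>k'<c. C $$ (k, k') * C' $$ (k', r)) * T p q r)"
      unfolding prod3_sum by (simp only: mult_ac)
    also have "\<dots> = tensor_act a b c (A * A') (B * B') (C * C') T i j k"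
      using True A B C by (simp add: tensor_act_def scalar_prod_def lessThan_atLeast0)
    finally show ?thesis .
  qed (auto simp: tensor_act_def)
qed

lemma continuous_on_tensor_act: "continuous_on X (tensor_act a b c A B C)"
proof (intro continuous_on_coordinatewise_then_product)
  fix i j k
  show "continuous_on X (\<lambda>T. tensor_act a b c A B C T i j k)"
    by (cases "i < a \<and> j < b \<and> k < c") (auto simp: tensor_act_def intro!: continuous_intros)
qed

text \<open>A group element maps the orbit into itself and acts continuously, hence it also maps the
  closure into itself.\<close>

lemma tensor_act_closure_orbit:
  assumes S: "S \<in> closure (GL_orbit a b c T)" and "A \<in> GL a" "B \<in> GL b" "C \<in> GL c"
  shows "tensor_act a b c A B C S \<in> closure (GL_orbit a b c T)"
proof -
  have "tensor_act a b c A B C ` GL_orbit a b c T \<subseteq> GL_orbit a b c T"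
  proof safe
    fix R assume "R \<in> GL_orbit a b c T"
    then obtain A' B' C' where "A' \<in> GL a" "B' \<in> GL b" "C' \<in> GL c" "R = tensor_act a b c A' B' C' T"
      by (auto simp: GL_orbit_def)
    moreover from this assms have "tensor_act a b c A B C R = tensor_act a b c (A * A') (B * B') (C * C') T"
      by (simp add: tensor_act_act GL_def)
    ultimately show "tensor_act a b c A B C R \<in> GL_orbit a b c T"
      using GL_mult assms unfolding GL_orbit_def by blast
  qed
  then have "tensor_act a b c A B C ` closure (GL_orbit a b c T) \<subseteq> closure (GL_orbit a b c T)"
    by (intro image_closure_subset continuous_on_tensor_act) (auto intro: closure_subset[THEN subsetD])
  then show ?thesis using S by blast
qed

text \<open>The perturbed matrix is singular only if \<open>- e\<close> is an eigenvalue of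
  \<open>A\<close>, which excludes finitely many \<open>e\<close>.\<close>

lemma eventually_GL:
  assumes A: "A \<in> carrier_mat n n"
  shows "\<forall>\<^sub>F e in at (0 :: complex). A + e \<cdot>\<^sub>m 1\<^sub>m n \<in> GL n"
proof -
  have "char_poly A \<noteq> 0" using degree_monic_char_poly[OF A] by auto
  then have "finite (uminus ` {e. poly (char_poly A) e = 0})" by (simp add: poly_roots_finite)
  then have "\<forall>\<^sub>F e in at 0. e \<notin> uminus ` {e. poly (char_poly A) e = 0}"
    using islimpt_finite islimpt_iff_eventually by blast
  then show ?thesis
  proof eventually_elim
    case (elim e)
    then have "poly (char_poly A) (- e) \<noteq> 0" by force
    then have "det (char_matrix A (- e)) \<noteq> 0"
      using eigenvalue_root_char_poly[OF A] eigenvalue_det[OF A] by blast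
    moreover have "char_matrix A (- e) = A + e \<cdot>\<^sub>m 1\<^sub>m n" using A by (simp add: char_matrix_def)
    ultimately have d: "det (A + e \<cdot>\<^sub>m 1\<^sub>m n) \<noteq> 0" by simp
    let ?M = "A + e \<cdot>\<^sub>m 1\<^sub>m n"
    have M: "?M \<in> carrier_mat n n" using A by auto
    have "?M * ((1 / det ?M) \<cdot>\<^sub>m adj_mat ?M) = (1 / det ?M) \<cdot>\<^sub>m (?M * adj_mat ?M)"
      by (rule mult_smult_distrib[OF M adj_mat(1)[OF M]])
    also have "\<dots> = 1\<^sub>m n" unfolding adj_mat(2)[OF M] using d by (intro eq_matI) auto
    finally show ?case using M adj_mat(1)[OF M] by (intro GL_I[of _ _ "(1 / det ?M) \<cdot>\<^sub>m adj_mat ?M"]) auto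
  qed
qed

text \<open>Singular matrices are limits of invertible ones, so degenerations by arbitrary square
  matrices stay in the closure.\<close>

lemma tensor_act_in_closure_orbit:
  assumes A: "A \<in> carrier_mat a a" and B: "B \<in> carrier_mat b b" and C: "C \<in> carrier_mat c c"
  shows "tensor_act a b c A B C T \<in> closure (GL_orbit a b c T)"
proof (rule Lim_in_closed_set)
  let ?R = "\<lambda>e. tensor_act a b c (A + e \<cdot>\<^sub>m 1\<^sub>m a) (B + e \<cdot>\<^sub>m 1\<^sub>m b) (C + e \<cdot>\<^sub>m 1\<^sub>m c) T"
  show "\<forall>\<^sub>F e in at (0 :: complex). ?R e \<in> closure (GL_orbit a b c T)"
    using eventually_GL[OF A] eventually_GL[OF B] eventually_GL[OF C]
    by eventually_elim (rule closure_subset[THEN subsetD], auto simp: GL_orbit_def)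
  show "(?R \<longlongrightarrow> tensor_act a b c A B C T) (at 0)"
  proof (intro tendsto_fun_coordwise)
    have entry: "((\<lambda>e. (M + e \<cdot>\<^sub>m 1\<^sub>m n) $$ (p, q)) \<longlongrightarrow> M $$ (p, q)) (at (0 :: complex))"
      if "M \<in> carrier_mat n n" "p < n" "q < n" for M n p q
    proof -
      have "((\<lambda>e. M $$ (p, q) + e * 1\<^sub>m n $$ (p, q)) \<longlongrightarrow> M $$ (p, q) + 0 * 1\<^sub>m n $$ (p, q)) (at (0 :: complex))"
        by (intro tendsto_intros)
      then show ?thesis using that by simp
    qed
    fix i j k
    show "((\<lambda>e. ?R e i j k) \<longlongrightarrow> tensor_act a b c A B C T i j k) (at 0)"
    proof (cases "i < a \<and> j < b \<and> k < c")
      case True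
      then show ?thesis unfolding tensor_act_def
        by (simp only: simp_thms if_True) (intro tendsto_sum tendsto_mult tendsto_const entry A B C; simp)
    qed (auto simp: tensor_act_def)
  qed
qed auto

text \<open>For a unit vector \<open>(x, y)\<close> the map from \<open>(s, t)\<close> to the two
  combinations on the left is unitary. It is the change of basis that makes a chosen member of the
  pencil its first slice.\<close>

lemma pencil_unit_identity:
  assumes "(cmod x)\<^sup>2 + (cmod y)\<^sup>2 = 1"
  shows "(cmod (x * s + y * t))\<^sup>2 + (cmod (cnj x * t - cnj y * s))\<^sup>2 = (cmod s)\<^sup>2 + (cmod t)\<^sup>2"
proof -
  have "complex_of_real ((cmod (x * s + y * t))\<^sup>2 + (cmod (cnj x * t - cnj y * s))\<^sup>2) =
      complex_of_real (((cmod x)\<^sup>2 + (cmod y)\<^sup>2) * ((cmod s)\<^sup>2 + (cmod t)\<^sup>2))"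
    unfolding of_real_add of_real_mult complex_norm_square by (simp add: algebra_simps)
  then show ?thesis unfolding of_real_eq_iff assms by simp
qed

text \<open>
  If \<open>v\<close> is annihilated by the unit combination \<open>x S\<^sub>0 + y S\<^sub>1\<close>, then the whole mass \<open>\<alpha>\<close> of the row vector
  is carried by the orthogonal combination \<open>Q\<close>, whose operator norm is at most \<open>sqrt \<beta>\<close>.
\<close>

lemma pencil_kernel_trivial:
  fixes S0 S1 :: "nat \<Rightarrow> nat \<Rightarrow> complex"
  assumes row: "(\<Sum>k<m. (cmod (\<Sum>j<l. v j * S0 j k))\<^sup>2 + (cmod (\<Sum>j<l. v j * S1 j k))\<^sup>2) =
      \<alpha> * (\<Sum>j<l. (cmod (v j))\<^sup>2)"
    and col: "\<And>w. (\<Sum>j<l. (cmod (\<Sum>k<m. w k * S0 j k))\<^sup>2 + (cmod (\<Sum>k<m. w k * S1 j k))\<^sup>2) \<le>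
      \<beta> * (\<Sum>k<m. (cmod (w k))\<^sup>2)"
    and ab: "0 < \<alpha>" "\<beta> < \<alpha>"
    and xy: "(cmod x)\<^sup>2 + (cmod y)\<^sup>2 = 1"
    and ker: "\<And>k. k < m \<Longrightarrow> (\<Sum>j<l. v j * (x * S0 j k + y * S1 j k)) = 0"
  shows "(\<Sum>j<l. (cmod (v j))\<^sup>2) = 0"
proof (rule ccontr)
  let ?V = "\<Sum>j<l. (cmod (v j))\<^sup>2"
  assume "?V \<noteq> 0"
  then have V: "?V > 0" using sum_nonneg[of "{..<l}" "\<lambda>j. (cmod (v j))\<^sup>2"] by simp
  define Q where "Q j k = cnj x * S1 j k - cnj y * S0 j k" for j k
  define q where "q k = (\<Sum>j<l. v j * Q j k)" for k
  define t where "t j = (\<Sum>k<m. cnj (q k) * Q j k)" for j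
  let ?W = "\<Sum>k<m. (cmod (q k))\<^sup>2"
  have "(cmod (q k))\<^sup>2 = (cmod (\<Sum>j<l. v j * S0 j k))\<^sup>2 + (cmod (\<Sum>j<l. v j * S1 j k))\<^sup>2"
    if "k < m" for k
  proof -
    have "x * (\<Sum>j<l. v j * S0 j k) + y * (\<Sum>j<l. v j * S1 j k) = (\<Sum>j<l. v j * (x * S0 j k + y * S1 j k))"
      by (simp add: sum_distrib_left sum.distrib algebra_simps)
    moreover have "cnj x * (\<Sum>j<l. v j * S1 j k) - cnj y * (\<Sum>j<l. v j * S0 j k) = q k"
      by (simp add: q_def Q_def sum_distrib_left sum_subtractf algebra_simps)
    ultimately show ?thesis
      using pencil_unit_identity[OF xy, of "\<Sum>j<l. v j * S0 j k" "\<Sum>j<l. v j * S1 j k"] ker[OF that] by simp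
  qed
  then have W: "?W = \<alpha> * ?V" using row by simp
  have "(cmod (t j))\<^sup>2 \<le> (cmod (\<Sum>k<m. cnj (q k) * S0 j k))\<^sup>2 + (cmod (\<Sum>k<m. cnj (q k) * S1 j k))\<^sup>2" for j
  proof -
    have tj: "t j = cnj x * (\<Sum>k<m. cnj (q k) * S1 j k) - cnj y * (\<Sum>k<m. cnj (q k) * S0 j k)"
      by (simp add: t_def Q_def sum_distrib_left sum_subtractf algebra_simps)
    show ?thesis unfolding tj
      using pencil_unit_identity[OF xy, of "\<Sum>k<m. cnj (q k) * S0 j k" "\<Sum>k<m. cnj (q k) * S1 j k"]
        zero_le_power2[of "cmod (x * (\<Sum>k<m. cnj (q k) * S0 j k) + y * (\<Sum>k<m. cnj (q k) * S1 j k))"]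
      by linarith
  qed
  then have "(\<Sum>j<l. (cmod (t j))\<^sup>2) \<le>
      (\<Sum>j<l. (cmod (\<Sum>k<m. cnj (q k) * S0 j k))\<^sup>2 + (cmod (\<Sum>k<m. cnj (q k) * S1 j k))\<^sup>2)"
    by (intro sum_mono)
  also have "\<dots> \<le> \<beta> * ?W" using col[of "\<lambda>k. cnj (q k)"] by simp
  finally have t: "(\<Sum>j<l. (cmod (t j))\<^sup>2) \<le> \<beta> * ?W" .
  \<comment> \<open>The mass \<open>?W\<close> is the pairing of \<open>v\<close> with
    \<open>t\<close>. By Cauchy-Schwarz \<open>?W\<^sup>2\<close> is at most \<open>?V\<close> times
    the squared norm of \<open>t\<close>, hence at most \<open>?V * \<beta> * ?W\<close>. Together
    with \<open>?W = \<alpha> * ?V\<close> this forces \<alpha> \<le> \<beta>.\<close>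
  have "complex_of_real ?W = (\<Sum>k<m. cnj (q k) * q k)"
    by (simp add: complex_norm_square mult.commute del: of_real_power)
  also have "\<dots> = (\<Sum>k<m. \<Sum>j<l. v j * (cnj (q k) * Q j k))"
    by (subst (2) q_def) (simp add: sum_distrib_left mult_ac)
  also have "\<dots> = (\<Sum>j<l. v j * t j)"
    by (subst sum.swap) (simp add: t_def sum_distrib_left)
  finally have Wt: "complex_of_real ?W = (\<Sum>j<l. v j * t j)" .
  have W0: "0 \<le> ?W" by (simp add: sum_nonneg)
  then have "?W = cmod (complex_of_real ?W)" by (simp only: norm_of_real abs_of_nonneg)
  also have "\<dots> = cmod (\<Sum>j<l. v j * t j)" by (simp only: Wt)
  also have "\<dots> \<le> (\<Sum>j<l. cmod (v j) * cmod (t j))"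
    by (rule order_trans[OF norm_sum]) (simp add: norm_mult)
  finally have "?W\<^sup>2 \<le> (\<Sum>j<l. cmod (v j) * cmod (t j))\<^sup>2"
    using W0 by (rule power_mono)
  also have "\<dots> \<le> ?V * (\<Sum>j<l. (cmod (t j))\<^sup>2)" by (rule Cauchy_Schwarz_ineq_sum)
  also have "\<dots> \<le> ?V * (\<beta> * ?W)" using V t by (intro mult_left_mono) auto
  finally have "?W * ?W \<le> (\<beta> * ?V) * ?W" by (simp add: power2_eq_square mult_ac)
  moreover have "?W > 0" unfolding W using ab V by simp
  ultimately have "?W \<le> \<beta> * ?V" by (simp only: mult_le_cancel_right_pos)
  then show False unfolding W using ab V by simp
qed

lemma bounded_coordinates_convergent_subseq:
  fixes z :: "nat \<Rightarrow> nat \<Rightarrow> 'a :: heine_borel"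
  assumes "\<And>i. i < d \<Longrightarrow> bounded (range (\<lambda>n. z n i))"
  shows "\<exists>l r. strict_mono (r :: nat \<Rightarrow> nat) \<and> (\<forall>i<d. (\<lambda>n. z (r n) i) \<longlonglongrightarrow> l i)"
  using assms
proof (induction d)
  case 0
  then show ?case using strict_mono_id by auto
next
  case (Suc d)
  then obtain l r where r: "strict_mono (r :: nat \<Rightarrow> nat)" "\<forall>i<d. (\<lambda>n. z (r n) i) \<longlonglongrightarrow> l i"
    by force
  have "bounded (range (\<lambda>n. z (r n) d))"
    by (rule bounded_subset[OF Suc.prems[of d]]) auto
  then obtain l' r' where r': "strict_mono (r' :: nat \<Rightarrow> nat)" "((\<lambda>n. z (r n) d) \<circ> r') \<longlonglongrightarrow> l'"
    using bounded_imp_convergent_subsequence by blast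
  have "(\<lambda>n. z ((r \<circ> r') n) i) \<longlonglongrightarrow> (l(d := l')) i" if "i < Suc d" for i
  proof (cases "i = d")
    case False
    then have "(\<lambda>n. z (r n) i) \<longlonglongrightarrow> l i" using that r by simp
    from LIMSEQ_subseq_LIMSEQ[OF this r'(1)] show ?thesis using False by (simp add: o_def)
  qed (use r' in \<open>simp add: o_def\<close>)
  then show ?case using strict_mono_o[OF r(1) r'(1)] by blast
qed

section \<open>Degenerate pencils\<close>

text \<open>Some combination of the slices \<open>0\<close> and \<open>1\<close>, cut down to its
  first \<open>l\<close> rows, has a left kernel vector. Coefficients and vector are normalised so
  that the witnesses range over a compact set; witnesses that are merely nonzero could tend to
  \<open>0\<close> in a limit.\<close>

definition degenerate_pencil :: "nat \<Rightarrow> nat \<Rightarrow> tensor \<Rightarrow> bool" where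
  "degenerate_pencil l m R \<longleftrightarrow> (\<exists>x y v. (cmod x)\<^sup>2 + (cmod y)\<^sup>2 = 1 \<and> (\<Sum>j<l. (cmod (v j))\<^sup>2) = 1 \<and>
     (\<forall>k<m. (\<Sum>j<l. v j * (x * R 0 j k + y * R 1 j k)) = 0))"

lemma degenerate_pencil_closure:
  assumes R: "R \<in> closure X" and X: "\<And>R. R \<in> X \<Longrightarrow> degenerate_pencil l m R"
  shows "degenerate_pencil l m R"
proof -
  obtain Q where QX: "\<And>n. Q n \<in> X" and Q: "Q \<longlonglongrightarrow> R"
    using R by (auto simp: closure_sequential)
  have Qc: "(\<lambda>n. Q n i j k) \<longlonglongrightarrow> R i j k" for i j k
    using continuous_on_tendsto_compose[OF continuous_on_coord Q, of UNIV i j k] by simp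
  define P where "P n x y v \<longleftrightarrow> (cmod x)\<^sup>2 + (cmod y)\<^sup>2 = 1 \<and> (\<Sum>j<l. (cmod (v j))\<^sup>2) = 1 \<and>
     (\<forall>k<m. (\<Sum>j<l. v j * (x * Q n 0 j k + y * Q n 1 j k)) = 0)" for n x y v
  have "\<forall>n. \<exists>x y v. P n x y v"
    using X[OF QX] unfolding degenerate_pencil_def P_def by blast
  then obtain x y v where "\<And>n. P n (x n) (y n) (v n)" by metis
  then have xy: "\<And>n. (cmod (x n))\<^sup>2 + (cmod (y n))\<^sup>2 = 1"
    and v: "\<And>n. (\<Sum>j<l. (cmod (v n j))\<^sup>2) = 1"
    and ker: "\<And>n k. k < m \<Longrightarrow> (\<Sum>j<l. v n j * (x n * Q n 0 j k + y n * Q n 1 j k)) = 0"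
    by (auto simp: P_def)
  \<comment> \<open>All witnesses are packed into \<open>l + 2\<close> bounded coordinates,
    \<open>x\<close> at place \<open>l\<close> and \<open>y\<close> at place \<open>l + 1\<close>,
    so that one subsequence serves for all of them.\<close>
  define z where "z n i = (if i < l then v n i else if i = l then x n else y n)" for n i
  have bd: "cmod u \<le> 1" if "(cmod u)\<^sup>2 \<le> 1" for u
    using that by (simp add: abs_square_le_1)
  have "cmod (z n i) \<le> 1" for n i
  proof (rule bd)
    have "i < l \<Longrightarrow> (cmod (v n i))\<^sup>2 \<le> (\<Sum>j<l. (cmod (v n j))\<^sup>2)"
      by (rule member_le_sum) auto
    moreover have "(cmod (x n))\<^sup>2 \<le> 1" "(cmod (y n))\<^sup>2 \<le> 1"
      using xy[of n] zero_le_power2[of "cmod (x n)"] zero_le_power2[of "cmod (y n)"] by linarith+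
    ultimately show "(cmod (z n i))\<^sup>2 \<le> 1" using v[of n] by (simp add: z_def)
  qed
  then have "bounded (range (\<lambda>n. z n i))" for i by (auto simp: bounded_iff)
  then obtain w r where r: "strict_mono (r :: nat \<Rightarrow> nat)" and
    w: "\<And>i. i < l + 2 \<Longrightarrow> (\<lambda>n. z (r n) i) \<longlonglongrightarrow> w i"
    using bounded_coordinates_convergent_subseq[of "l + 2" z] by blast
  have Lx: "(\<lambda>n. x (r n)) \<longlonglongrightarrow> w l" and Ly: "(\<lambda>n. y (r n)) \<longlonglongrightarrow> w (l + 1)"
    using w[of l] w[of "l + 1"] by (auto simp: z_def)
  have Lv: "(\<lambda>n. v (r n) j) \<longlonglongrightarrow> w j" if "j < l" for j using w[of j] that by (simp add: z_def)
  have LQ: "(\<lambda>n. Q (r n) i j k) \<longlonglongrightarrow> R i j k" for i j k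
    using LIMSEQ_subseq_LIMSEQ[OF Qc r] by (simp add: o_def)
  show ?thesis unfolding degenerate_pencil_def
  proof (intro exI conjI allI impI)
    have "(\<lambda>n. (cmod (x (r n)))\<^sup>2 + (cmod (y (r n)))\<^sup>2) \<longlonglongrightarrow> (cmod (w l))\<^sup>2 + (cmod (w (l + 1)))\<^sup>2"
      by (intro tendsto_intros Lx Ly)
    then show "(cmod (w l))\<^sup>2 + (cmod (w (l + 1)))\<^sup>2 = 1" using xy by (simp add: LIMSEQ_const_iff)
    have "(\<lambda>n. \<Sum>j<l. (cmod (v (r n) j))\<^sup>2) \<longlonglongrightarrow> (\<Sum>j<l. (cmod (w j))\<^sup>2)"
      by (intro tendsto_intros Lv) auto
    then show "(\<Sum>j<l. (cmod (w j))\<^sup>2) = 1" using v by (simp add: LIMSEQ_const_iff)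
    fix k assume k: "k < m"
    have "(\<lambda>n. \<Sum>j<l. v (r n) j * (x (r n) * Q (r n) 0 j k + y (r n) * Q (r n) 1 j k)) \<longlonglongrightarrow>
        (\<Sum>j<l. w j * (w l * R 0 j k + w (l + 1) * R 1 j k))"
      by (intro tendsto_intros Lv Lx Ly LQ) auto
    then show "(\<Sum>j<l. w j * (w l * R 0 j k + w (l + 1) * R 1 j k)) = 0"
      using ker[OF k] by (simp add: LIMSEQ_const_iff)
  qed
qed

text \<open>The kernel equation is homogeneous in \<open>(x, y)\<close> and in \<open>v\<close>, so
  nonzero witnesses can be rescaled to unit length.\<close>

lemma degenerate_pencilI:
  assumes xy: "x \<noteq> 0 \<or> y \<noteq> 0" and v: "j0 < l" "v j0 \<noteq> 0"
    and ker: "\<And>k. k < m \<Longrightarrow> (\<Sum>j<l. v j * (x * R 0 j k + y * R 1 j k)) = 0"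
  shows "degenerate_pencil l m R"
proof -
  define s where "s = sqrt ((cmod x)\<^sup>2 + (cmod y)\<^sup>2)"
  define t where "t = sqrt (\<Sum>j<l. (cmod (v j))\<^sup>2)"
  have "(cmod x)\<^sup>2 + (cmod y)\<^sup>2 > 0" using xy by (auto simp: add_pos_nonneg add_nonneg_pos)
  then have s: "s\<^sup>2 = (cmod x)\<^sup>2 + (cmod y)\<^sup>2" "s\<^sup>2 > 0" by (auto simp: s_def)
  have "(\<Sum>j<l. (cmod (v j))\<^sup>2) > 0" using v by (intro sum_pos2[of _ j0]) auto
  then have t: "t\<^sup>2 = (\<Sum>j<l. (cmod (v j))\<^sup>2)" "t\<^sup>2 > 0" by (auto simp: t_def)
  show ?thesis unfolding degenerate_pencil_def
  proof (intro exI conjI allI impI)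
    show "(cmod (x / of_real s))\<^sup>2 + (cmod (y / of_real s))\<^sup>2 = 1"
      using s xy by (simp add: norm_divide power_divide flip: add_divide_distrib)
    show "(\<Sum>j<l. (cmod (v j / of_real t))\<^sup>2) = 1"
      using t by (simp add: norm_divide power_divide flip: sum_divide_distrib)
    fix k assume "k < m"
    have "(\<Sum>j<l. v j / of_real t * (x / of_real s * R 0 j k + y / of_real s * R 1 j k)) =
        (\<Sum>j<l. v j * (x * R 0 j k + y * R 1 j k)) / (of_real t * of_real s)"
      unfolding sum_divide_distrib by (intro sum.cong refl) (simp add: add_divide_distrib distrib_left)
    then show "(\<Sum>j<l. v j / of_real t * (x / of_real s * R 0 j k + y / of_real s * R 1 j k)) = 0"
      using ker[OF \<open>k < m\<close>] by simp
  qed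
qed

section \<open>Singular members of pencils in the matrix multiplication orbit\<close>

lemma singular_pencil_member:
  fixes X Y :: "complex mat"
  assumes X: "X \<in> carrier_mat n n" and Y: "Y \<in> carrier_mat n n" and n: "n > 0"
  obtains x y where "x \<noteq> 0 \<or> y \<noteq> 0" "det (x \<cdot>\<^sub>m X + y \<cdot>\<^sub>m Y) = 0"
proof (cases "det Y = 0")
  case True
  have "0 \<cdot>\<^sub>m X + 1 \<cdot>\<^sub>m Y = Y" using X Y by (intro eq_matI) auto
  then show ?thesis using that[of 0 1] True by simp
next
  case False
  \<comment> \<open>\<open>M\<close> is the inverse of \<open>Y\<close> times \<open>X\<close>. If
    \<open>e\<close> is an eigenvalue of \<open>M\<close>, then \<open>X - e Y = Y (M - e)\<close>
    is singular.\<close>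
  define M where "M = (1 / det Y) \<cdot>\<^sub>m (adj_mat Y * X)"
  have M: "M \<in> carrier_mat n n" using adj_mat(1)[OF Y] X by (auto simp: M_def)
  have "degree (char_poly M) \<noteq> 0" using degree_monic_char_poly[OF M] n by simp
  then obtain e where "poly (char_poly M) e = 0"
    using fundamental_theorem_of_algebra constant_degree by metis
  then have e: "det (char_matrix M e) = 0"
    using eigenvalue_root_char_poly[OF M] eigenvalue_det[OF M] by blast
  have "Y * M = X"
  proof -
    have "Y * M = (1 / det Y) \<cdot>\<^sub>m (Y * (adj_mat Y * X))"
      unfolding M_def using adj_mat(1)[OF Y] X by (intro mult_smult_distrib[OF Y]) auto
    also have "Y * (adj_mat Y * X) = Y * adj_mat Y * X"
      using adj_mat(1)[OF Y] X Y by (simp add: assoc_mult_mat[of _ n n _ n _ n])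
    also have "\<dots> = det Y \<cdot>\<^sub>m X" unfolding adj_mat(2)[OF Y] using X
      by (simp add: mult_smult_assoc_mat[of _ n n _ n])
    finally show ?thesis using False X by (intro eq_matI) auto
  qed
  then have "1 \<cdot>\<^sub>m X + (- e) \<cdot>\<^sub>m Y = Y * char_matrix M e"
    using X Y M by (simp add: char_matrix_def mult_add_distrib_mat[of _ n n _ n] mult_smult_distrib[of _ n n _ n])
      (auto intro!: eq_matI)
  then have "det (1 \<cdot>\<^sub>m X + (- e) \<cdot>\<^sub>m Y) = 0" using det_mult[OF Y, of "char_matrix M e"] M e by simp
  then show ?thesis using that[of 1 "- e"] by simp
qed

lemma kernel_vector_of_singular:
  fixes M :: "complex mat"
  assumes "M \<in> carrier_mat n n" "det M = 0"
  obtains d i0 where "i0 < n" "d i0 \<noteq> 0" "\<And>i. i < n \<Longrightarrow> (\<Sum>j<n. M $$ (i, j) * d j) = 0"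
proof -
  obtain u where u: "u \<in> carrier_vec n" "u \<noteq> 0\<^sub>v n" "M *\<^sub>v u = 0\<^sub>v n"
    using assms det_0_iff_vec_prod_zero by blast
  obtain i0 where "i0 < n" "u $ i0 \<noteq> 0" using u(1,2) by (metis carrier_vecD eq_vecI index_zero_vec)
  moreover have "(\<Sum>j<n. M $$ (i, j) * u $ j) = 0" if "i < n" for i
    using arg_cong[OF u(3), of "\<lambda>v. v $ i"] that assms(1) u(1)
    by (simp add: scalar_prod_def lessThan_atLeast0)
  ultimately show ?thesis using that by blast
qed

text \<open>Zero rows complete the system to a square singular matrix.\<close>

lemma underdetermined_system:
  fixes E :: "nat \<Rightarrow> nat \<Rightarrow> complex"
  assumes "r < n"
  obtains d i0 where "i0 < n" "d i0 \<noteq> 0" "\<And>i. i < r \<Longrightarrow> (\<Sum>j<n. E i j * d j) = 0"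
proof -
  define M where "M = Matrix.mat n n (\<lambda>(i, j). if i < r then E i j else 0)"
  have M: "M \<in> carrier_mat n n" by (simp add: M_def)
  have eq: "mat\<^sub>r n n (\<lambda>i. if i = r then 0\<^sub>v n else Matrix.row M i) = M"
    using assms by (intro eq_matI) (auto simp: M_def)
  have "det M = 0"
    using det_row_0[OF assms, of "Matrix.row M"] M unfolding eq by auto
  then obtain d i0 where d: "i0 < n" "d i0 \<noteq> 0" "\<And>i. i < n \<Longrightarrow> (\<Sum>j<n. M $$ (i, j) * d j) = 0"
    using kernel_vector_of_singular[OF M] by blast
  have "(\<Sum>j<n. E i j * d j) = 0" if "i < r" for i
    using d(3)[of i] that assms by (simp add: M_def)
  then show ?thesis using that d(1,2) by blast
qed

lemma sum_std_basis: "a < m \<Longrightarrow> (\<Sum>p<m. f p * std_basis a p) = f a"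
  by (simp add: std_basis_def if_distrib[of "(*) _"] cong: if_cong)

lemma sum_matmul_tensor:
  "(\<Sum>p<n\<^sup>2. \<Sum>q<n\<^sup>2. \<Sum>r<n\<^sup>2. F p q r * matmul_tensor n p q r) =
    (\<Sum>i<n. \<Sum>j<n. \<Sum>k<n. F (i * n + j) (j * n + k) (k * n + i))"
proof -
  have "(\<Sum>p<n\<^sup>2. \<Sum>q<n\<^sup>2. \<Sum>r<n\<^sup>2. F p q r * matmul_tensor n p q r) =
      (\<Sum>p<n\<^sup>2. \<Sum>q<n\<^sup>2. \<Sum>r<n\<^sup>2. \<Sum>i<n. \<Sum>j<n. \<Sum>k<n.
        F p q r * (std_basis (i * n + j) p * std_basis (j * n + k) q * std_basis (k * n + i) r))"
    by (simp only: matmul_tensor_def sum_distrib_left)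
  also have "\<dots> = (\<Sum>i<n. \<Sum>j<n. \<Sum>k<n. \<Sum>p<n\<^sup>2. \<Sum>q<n\<^sup>2. \<Sum>r<n\<^sup>2.
        F p q r * (std_basis (i * n + j) p * std_basis (j * n + k) q * std_basis (k * n + i) r))"
    by (rule sum_swap33)
  also have "\<dots> = (\<Sum>i<n. \<Sum>j<n. \<Sum>k<n. F (i * n + j) (j * n + k) (k * n + i))"
  proof (intro sum.cong refl)
    fix i j k assume "i \<in> {..<n}" "j \<in> {..<n}" "k \<in> {..<n}"
    then have lt: "i * n + j < n\<^sup>2" "j * n + k < n\<^sup>2" "k * n + i < n\<^sup>2"
      using nat_index_less[of _ n _ n] by (auto simp: power2_eq_square)
    have "(\<Sum>p<n\<^sup>2. \<Sum>q<n\<^sup>2. \<Sum>r<n\<^sup>2.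
        F p q r * (std_basis (i * n + j) p * std_basis (j * n + k) q * std_basis (k * n + i) r)) =
      (\<Sum>p<n\<^sup>2. (\<Sum>q<n\<^sup>2. (\<Sum>r<n\<^sup>2. F p q r * std_basis (k * n + i) r) *
        std_basis (j * n + k) q) * std_basis (i * n + j) p)"
      by (simp add: sum_distrib_right sum_distrib_left mult_ac)
    then show "(\<Sum>p<n\<^sup>2. \<Sum>q<n\<^sup>2. \<Sum>r<n\<^sup>2.
        F p q r * (std_basis (i * n + j) p * std_basis (j * n + k) q * std_basis (k * n + i) r)) =
      F (i * n + j) (j * n + k) (k * n + i)"
      using lt by (simp add: sum_std_basis)
  qed
  finally show ?thesis .
qed

text \<open>
  Some nonzero combination of the first two slices is \<open>X \<otimes> 1\<close> up to invertible factors, with \<open>X\<close> a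
  singular \<open>n \<times> n\<close> matrix. Its left kernel has dimension at least \<open>n\<close> and hence meets the span of
  the first \<open>l > n\<^sup>2 - n\<close> coordinates.
\<close>

lemma matmul_orbit_degenerate:
  assumes n: "2 \<le> n" and l: "l \<le> n\<^sup>2" "n\<^sup>2 < l + n"
    and R: "R \<in> GL_orbit (n\<^sup>2) (n\<^sup>2) (n\<^sup>2) (matmul_tensor n)"
  shows "degenerate_pencil l (n\<^sup>2) R"
proof -
  obtain A B C where B: "B \<in> GL (n\<^sup>2)" and
    R: "R = tensor_act (n\<^sup>2) (n\<^sup>2) (n\<^sup>2) A B C (matmul_tensor n)"
    using R by (auto simp: GL_orbit_def)
  obtain B' where Bc: "B \<in> carrier_mat (n\<^sup>2) (n\<^sup>2)" "B' \<in> carrier_mat (n\<^sup>2) (n\<^sup>2)" "B' * B = 1\<^sub>m (n\<^sup>2)"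
    using B by (rule GL_E)
  have "2 * 2 \<le> n\<^sup>2" unfolding power2_eq_square using n by (intro mult_le_mono)
  then have n2: "1 < n\<^sup>2" by simp
  define X where "X e = Matrix.mat n n (\<lambda>(i, j). A $$ (e, i * n + j))" for e
  obtain x y where xy: "x \<noteq> 0 \<or> y \<noteq> 0" "det (x \<cdot>\<^sub>m X 0 + y \<cdot>\<^sub>m X 1) = 0"
    using singular_pencil_member[of "X 0" n "X 1"] n by (auto simp: X_def)
  \<comment> \<open>Read as an \<open>n\<close> by \<open>n\<close> matrix, \<phi> is the singular
    member of the pencil; \<open>d\<close> spans part of its right kernel.\<close>
  define \<phi> where "\<phi> p = x * A $$ (0, p) + y * A $$ (1, p)" for p
  have "x \<cdot>\<^sub>m X 0 + y \<cdot>\<^sub>m X 1 \<in> carrier_mat n n" by (simp add: X_def)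
  then obtain d i0 where d: "i0 < n" "d i0 \<noteq> 0"
    "\<And>i. i < n \<Longrightarrow> (\<Sum>j<n. (x \<cdot>\<^sub>m X 0 + y \<cdot>\<^sub>m X 1) $$ (i, j) * d j) = 0"
    using xy(2) by (rule kernel_vector_of_singular) blast
  have \<phi>d: "(\<Sum>j<n. \<phi> (i * n + j) * d j) = 0" if "i < n" for i
    using d(3)[OF that] that by (simp add: X_def \<phi>_def)
  \<comment> \<open>The vector \<open>v\<close> defined below has to vanish at the places from
    \<open>l\<close> on. For fixed \<open>d\<close> these are fewer than \<open>n\<close> linear
    conditions on the \<open>n\<close> entries of \<open>g\<close>.\<close>
  have "n\<^sup>2 - l < n" using l by linarith
  then obtain g k0 where g: "k0 < n" "g k0 \<noteq> 0"
    "\<And>r. r < n\<^sup>2 - l \<Longrightarrow> (\<Sum>k<n. (\<Sum>j<n. d j * B' $$ (j * n + k, l + r)) * g k) = 0"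
    by (rule underdetermined_system[where E = "\<lambda>r k. \<Sum>j<n. d j * B' $$ (j * n + k, l + r)"]) blast
  \<comment> \<open>For every \<open>g\<close> the vector \<open>d \<otimes> g\<close> is in the
    left kernel of the pencil that \<phi> cuts out of the matrix multiplication tensor. Multiplying
    it by the inverse of \<open>B\<close> carries it over to \<open>R\<close>, and
    \<open>v * B = u\<close> shows that \<open>v\<close> is nonzero.\<close>
  define u where "u p = d (p div n) * g (p mod n)" for p
  define v where "v q = (\<Sum>p<n\<^sup>2. u p * B' $$ (p, q))" for q
  have v0: "v q = 0" if q: "l \<le> q" "q < n\<^sup>2" for q
  proof -
    have "v q = (\<Sum>p<n * n. d (p div n) * g (p mod n) * B' $$ (p div n * n + p mod n, q))"
      by (simp add: v_def u_def power2_eq_square)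
    also have "\<dots> = (\<Sum>j<n. \<Sum>k<n. d j * g k * B' $$ (j * n + k, q))"
      by (rule sum_div_mod)
    also have "\<dots> = (\<Sum>k<n. (\<Sum>j<n. d j * B' $$ (j * n + k, q)) * g k)"
      by (subst sum.swap) (simp add: sum_distrib_left mult_ac)
    also have "\<dots> = 0" using g(3)[of "q - l"] q by simp
    finally show ?thesis .
  qed
  have vB: "(\<Sum>q<n\<^sup>2. v q * B $$ (q, p)) = u p" if p: "p < n\<^sup>2" for p
  proof -
    have "(\<Sum>q<n\<^sup>2. v q * B $$ (q, p)) = (\<Sum>s<n\<^sup>2. u s * (\<Sum>q<n\<^sup>2. B' $$ (s, q) * B $$ (q, p)))"
      by (simp add: v_def sum_distrib_left sum_distrib_right mult_ac) (rule sum.swap)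
    also have "\<dots> = (\<Sum>s<n\<^sup>2. u s * (B' * B) $$ (s, p))"
      using Bc(1,2) p by (simp add: scalar_prod_def lessThan_atLeast0)
    also have "\<dots> = (\<Sum>s<n\<^sup>2. if s = p then u s else 0)"
      unfolding Bc(3) using p by (intro sum.cong) auto
    finally show ?thesis using p by simp
  qed
  have "\<exists>j0<l. v j0 \<noteq> 0"
  proof (rule ccontr)
    assume "\<not> (\<exists>j0<l. v j0 \<noteq> 0)"
    then have "v q = 0" if "q < n\<^sup>2" for q using v0[OF _ that] by (cases "q < l") auto
    then have "u (i0 * n + k0) = 0"
      using vB[of "i0 * n + k0"] nat_index_less[OF d(1) g(1)] by (simp add: power2_eq_square)
    then show False using d g by (simp add: u_def)
  qed
  then obtain j0 where j0: "j0 < l" "v j0 \<noteq> 0" by blast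
  show ?thesis
  proof (rule degenerate_pencilI[where v = v, OF xy(1) j0])
    fix r assume r: "r < n\<^sup>2"
    have pencil: "x * R 0 q r + y * R 1 q r =
        (\<Sum>p<n\<^sup>2. \<Sum>s<n\<^sup>2. \<Sum>t<n\<^sup>2. \<phi> p * B $$ (q, s) * C $$ (r, t) * matmul_tensor n p s t)"
      if "q < n\<^sup>2" for q
      using that r n2 by (simp add: R tensor_act_def \<phi>_def sum_distrib_left sum.distrib algebra_simps)
    have "(\<Sum>j<l. v j * (x * R 0 j r + y * R 1 j r)) = (\<Sum>q<n\<^sup>2. v q * (x * R 0 q r + y * R 1 q r))"
      using l v0 by (intro sum.mono_neutral_left) auto
    also have "\<dots> = (\<Sum>q<n\<^sup>2. \<Sum>p<n\<^sup>2. \<Sum>s<n\<^sup>2. \<Sum>t<n\<^sup>2.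
        v q * (\<phi> p * B $$ (q, s) * C $$ (r, t) * matmul_tensor n p s t))"
      by (intro sum.cong refl) (simp only: lessThan_iff pencil sum_distrib_left)
    also have "\<dots> = (\<Sum>p<n\<^sup>2. \<Sum>s<n\<^sup>2. \<Sum>t<n\<^sup>2. \<Sum>q<n\<^sup>2.
        v q * (\<phi> p * B $$ (q, s) * C $$ (r, t) * matmul_tensor n p s t))"
      by (rule sum_swap4)
    also have "\<dots> = (\<Sum>p<n\<^sup>2. \<Sum>s<n\<^sup>2. \<Sum>t<n\<^sup>2. \<phi> p * u s * C $$ (r, t) * matmul_tensor n p s t)"
    proof (intro sum.cong refl)
      fix p s t assume "s \<in> {..<n\<^sup>2}"
      then have "\<phi> p * u s * C $$ (r, t) * matmul_tensor n p s t =
          \<phi> p * (\<Sum>q<n\<^sup>2. v q * B $$ (q, s)) * C $$ (r, t) * matmul_tensor n p s t" by (simp add: vB)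
      then show "(\<Sum>q<n\<^sup>2. v q * (\<phi> p * B $$ (q, s) * C $$ (r, t) * matmul_tensor n p s t)) =
          \<phi> p * u s * C $$ (r, t) * matmul_tensor n p s t"
        by (simp add: sum_distrib_left sum_distrib_right mult_ac)
    qed
    also have "\<dots> = (\<Sum>i<n. \<Sum>j<n. \<Sum>k<n. \<phi> (i * n + j) * u (j * n + k) * C $$ (r, k * n + i))"
      by (rule sum_matmul_tensor)
    \<comment> \<open>The index \<open>j\<close> is shared by the first two factors only, so its sum
      pairs \<phi> with its kernel vector.\<close>
    also have "\<dots> = (\<Sum>i<n. \<Sum>k<n. g k * C $$ (r, k * n + i) * (\<Sum>j<n. \<phi> (i * n + j) * d j))"
      by (rule sum.cong[OF refl], subst sum.swap) (simp add: u_def sum_distrib_left mult_ac)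
    also have "\<dots> = 0" by (simp add: \<phi>d)
    finally show "(\<Sum>j<l. v j * (x * R 0 j r + y * R 1 j r)) = 0" .
  qed
qed

section \<open>The point outside the matrix multiplication polytope\<close>

lemma nth_pad_uniform:
  "i < m \<Longrightarrow> pad m (uniform_vec l) ! i = (if i < l then 1 / real l else 0)"
  by (simp add: pad_def uniform_vec_def nth_append)

lemma sum_first_two:
  fixes f :: "nat \<Rightarrow> 'a :: comm_monoid_add"
  assumes "2 \<le> m" "\<And>i. 2 \<le> i \<Longrightarrow> i < m \<Longrightarrow> f i = 0"
  shows "(\<Sum>i<m. f i) = f 0 + f 1"
proof -
  have "(\<Sum>i<m. f i) = (\<Sum>i\<in>{0, 1}. f i)"
    using assms by (intro sum.mono_neutral_right) auto
  then show ?thesis by simp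
qed

lemma tensor_norm_pos:
  assumes "S \<in> tensor_space a b c" "S \<noteq> (\<lambda>_ _ _. 0)"
  shows "0 < tensor_norm a b c S"
proof -
  obtain i j k where "S i j k \<noteq> 0" using assms(2) by (auto simp: fun_eq_iff)
  moreover from this have "i < a" "j < b" "k < c" using assms(1) by (auto simp: tensor_space_def)
  ultimately show ?thesis using cmod_le_tensor_norm[of i a j b k c S] zero_less_norm_iff[of "S i j k"] by linarith
qed

lemma p_point_notin_matmul_polytope:
  assumes n: "2 \<le> n" and c: "n\<^sup>2 - n + 1 < c" "c \<le> n\<^sup>2"
  shows "pad3 (n\<^sup>2) (p_point c) \<notin> matmul_polytope n"
proof
  define m where "m = n\<^sup>2"
  define l where "l = c - 1"
  assume "pad3 (n\<^sup>2) (p_point c) \<in> matmul_polytope n"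
  then obtain S where S: "S \<in> closure (GL_orbit m m m (matmul_tensor n))" "S \<noteq> (\<lambda>_ _ _. 0)"
    and spec: "pad3 m (p_point c) = spec_moment m m m S"
    by (auto simp: moment_polytope_def m_def)
  have s: "spec (moment1 m m m S) = pad m (uniform_vec 2)" "spec (moment2 m m m S) = pad m (uniform_vec l)"
    "spec (moment3 m m m S) = pad m (uniform_vec c)"
    using spec by (auto simp: pad3_def p_point_def spec_moment_def l_def)
  have "n \<le> n\<^sup>2" by (simp add: power2_eq_square)
  moreover have "2 * 2 \<le> n\<^sup>2" unfolding power2_eq_square using n by (intro mult_le_mono)
  ultimately have m2: "2 \<le> m" and lm: "l \<le> m" "m < l + n" "c \<le> m" and cl: "c = l + 1" "0 < l"
    using c n by (auto simp: m_def l_def)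
  define N where "N = (tensor_norm m m m S)\<^sup>2"
  have "S \<in> tensor_space m m m"
    using S(1) closure_minimal[OF GL_orbit_subset closed_tensor_space] by blast
  then have "0 < tensor_norm m m m S" using S(2) by (rule tensor_norm_pos)
  then have N: "N > 0" by (simp add: N_def)
  obtain A B C where ABC: "A \<in> GL m" "B \<in> GL m" "C \<in> GL m" and
    form: "\<And>w. (\<Sum>j<m. \<Sum>k<m. (cmod (\<Sum>i<m. w i * tensor_act m m m A B C S i j k))\<^sup>2) / N =
      (\<Sum>i<m. pad m (uniform_vec 2) ! i * (cmod (w i))\<^sup>2)"
    "\<And>w. (\<Sum>i<m. \<Sum>k<m. (cmod (\<Sum>j<m. w j * tensor_act m m m A B C S i j k))\<^sup>2) / N =
      (\<Sum>j<m. pad m (uniform_vec l) ! j * (cmod (w j))\<^sup>2)"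
    "\<And>w. (\<Sum>i<m. \<Sum>j<m. (cmod (\<Sum>k<m. w k * tensor_act m m m A B C S i j k))\<^sup>2) / N =
      (\<Sum>k<m. pad m (uniform_vec c) ! k * (cmod (w k))\<^sup>2)"
    using moment_normal_form[of m m m S] unfolding s N_def by blast
  define R where "R = tensor_act m m m A B C S"
  have "R \<in> closure (GL_orbit m m m (matmul_tensor n))"
    unfolding R_def by (rule tensor_act_closure_orbit[OF S(1) ABC])
  then have "degenerate_pencil l m R"
    by (rule degenerate_pencil_closure)
      (use matmul_orbit_degenerate[OF n] lm in \<open>simp add: m_def\<close>)
  then obtain x y v where xy: "(cmod x)\<^sup>2 + (cmod y)\<^sup>2 = 1" and v: "(\<Sum>j<l. (cmod (v j))\<^sup>2) = 1"
    and ker: "\<And>k. k < m \<Longrightarrow> (\<Sum>j<l. v j * (x * R 0 j k + y * R 1 j k)) = 0"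
    unfolding degenerate_pencil_def by blast
  \<comment> \<open>The padded \<open>u_2\<close> vanishes from index \<open>2\<close> on; testing
    the first form with an indicator shows that these slices have norm zero, so \<open>R\<close>
    really is a pencil.\<close>
  have R0: "R p j k = 0" if p: "2 \<le> p" "p < m" and jk: "j < m" "k < m" for p j k
  proof -
    have "(\<Sum>i<m. (if i = p then 1 else 0) * R i j k) = R p j k" for j k
      using p by (simp add: if_distrib[of "\<lambda>z. z * _"] cong: if_cong)
    moreover have "(\<Sum>i<m. pad m (uniform_vec 2) ! i * (cmod (if i = p then 1 else 0))\<^sup>2) = 0"
      using p by (intro sum.neutral) (auto simp: nth_pad_uniform)
    ultimately have "(\<Sum>j<m. \<Sum>k<m. (cmod (R p j k))\<^sup>2) = 0"
      using form(1)[of "\<lambda>i. if i = p then 1 else 0"] N unfolding R_def[symmetric] by simp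
    then show ?thesis using jk by (simp add: sum_nonneg_eq_0_iff sum_nonneg)
  qed
  have "(\<Sum>j<l. (cmod (v j))\<^sup>2) = 0"
  \<comment> \<open>Here \<alpha> is \<open>N / l\<close> and \<beta> is \<open>N / c\<close>, so
    \<beta> < \<alpha> because \<open>c = l + 1\<close>. The row identity is exact, since
    \<open>v\<close> lives on the first \<open>l\<close> places, where all eigenvalues are
    \<open>1 / l\<close>. For the columns an upper bound is enough: the rows from \<open>l\<close>
    on are dropped and every padded eigenvalue is at most \<open>1 / c\<close>.\<close>
  proof (rule pencil_kernel_trivial[OF _ _ _ _ xy ker])
    let ?w = "\<lambda>j. if j < l then v j else 0"
    have w: "(\<Sum>j<m. ?w j * R i j k) = (\<Sum>j<l. v j * R i j k)" for i k
      using lm by (intro sum.mono_neutral_cong_right) auto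
    have "(\<Sum>k<m. (cmod (\<Sum>j<l. v j * R 0 j k))\<^sup>2 + (cmod (\<Sum>j<l. v j * R 1 j k))\<^sup>2) =
        (\<Sum>i<m. \<Sum>k<m. (cmod (\<Sum>j<l. v j * R i j k))\<^sup>2)"
      using R0 lm by (subst sum_first_two[OF m2]) (auto simp: sum.distrib)
    also have "\<dots> = N * (\<Sum>j<m. pad m (uniform_vec l) ! j * (cmod (?w j))\<^sup>2)"
      using form(2)[of ?w] N unfolding R_def[symmetric] w by (simp add: field_simps)
    also have "(\<Sum>j<m. pad m (uniform_vec l) ! j * (cmod (?w j))\<^sup>2) = (\<Sum>j<l. 1 / real l * (cmod (v j))\<^sup>2)"
      using lm by (intro sum.mono_neutral_cong_right) (auto simp: nth_pad_uniform)
    finally show "(\<Sum>k<m. (cmod (\<Sum>j<l. v j * R 0 j k))\<^sup>2 + (cmod (\<Sum>j<l. v j * R 1 j k))\<^sup>2) =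
        N / real l * (\<Sum>j<l. (cmod (v j))\<^sup>2)" by (simp flip: sum_divide_distrib)
    fix w :: "nat \<Rightarrow> complex"
    have "(\<Sum>j<l. (cmod (\<Sum>k<m. w k * R 0 j k))\<^sup>2 + (cmod (\<Sum>k<m. w k * R 1 j k))\<^sup>2) \<le>
        (\<Sum>j<m. (cmod (\<Sum>k<m. w k * R 0 j k))\<^sup>2 + (cmod (\<Sum>k<m. w k * R 1 j k))\<^sup>2)"
      using lm by (intro sum_mono2) auto
    also have "\<dots> = (\<Sum>i<m. \<Sum>j<m. (cmod (\<Sum>k<m. w k * R i j k))\<^sup>2)"
      using R0 by (subst sum_first_two[OF m2]) (auto simp: sum.distrib)
    also have "\<dots> = N * (\<Sum>k<m. pad m (uniform_vec c) ! k * (cmod (w k))\<^sup>2)"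
      using form(3)[of w] N unfolding R_def[symmetric] by (simp add: field_simps)
    also have "\<dots> \<le> N * (\<Sum>k<m. 1 / real c * (cmod (w k))\<^sup>2)"
      using N by (intro mult_left_mono sum_mono) (auto simp: nth_pad_uniform)
    finally show "(\<Sum>j<l. (cmod (\<Sum>k<m. w k * R 0 j k))\<^sup>2 + (cmod (\<Sum>k<m. w k * R 1 j k))\<^sup>2) \<le>
        N / real c * (\<Sum>k<m. (cmod (w k))\<^sup>2)" by (simp flip: sum_divide_distrib)
  qed (use N cl in \<open>auto simp: field_simps\<close>)
  then show False using v by simp
qed

section \<open>The point inside the unit tensor polytope\<close>

text \<open>A geometric sum whose ratio is a \<open>c\<close>-th root of unity. The ratio is
  \<open>1\<close> only for \<open>s = k\<close>, because exponents below \<open>c\<close> give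
  distinct roots.\<close>

lemma sum_roots_of_unity:
  assumes s: "s < c" and k: "k < c"
  shows "(\<Sum>p<c. cis (2 * pi * real s / real c) ^ p * cnj (cis (2 * pi * real k / real c)) ^ p) =
    (if s = k then of_nat c else 0)"
proof -
  let ?e = "\<lambda>s. cis (2 * pi * real s / real c)"
  define z where "z = ?e s * cnj (?e k)"
  have sum: "(\<Sum>p<c. ?e s ^ p * cnj (?e k) ^ p) = (\<Sum>p<c. z ^ p)"
    by (simp add: z_def power_mult_distrib)
  have root: "?e t ^ c = 1" for t
    using s by (simp add: DeMoivre)
  have unit: "cnj (?e k) * ?e k = 1" by (simp add: cis_cnj cis_mult)
  show ?thesis
  proof (cases "s = k")
    case True
    then have "z = 1" using unit by (simp add: z_def mult.commute)
    then show ?thesis using sum True by simp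
  next
    case False
    have "inj_on ?e {..<c}"
      using bij_betw_roots_unity[of c] s by (auto simp: bij_betw_def)
    then have "?e s \<noteq> ?e k" using False s k by (auto dest: inj_onD)
    moreover have "z * ?e k = ?e s" using unit by (simp add: z_def mult.assoc)
    ultimately have "z \<noteq> 1" by auto
    moreover have "z ^ c = 1"
      using root[of s] root[of k] by (simp add: z_def power_mult_distrib flip: complex_cnj_power)
    ultimately have "(\<Sum>p<c. z ^ p) = 0" by (simp add: geometric_sum)
    then show ?thesis using sum False by simp
  qed
qed

text \<open>The result is a sum of \<open>c\<close> rank-one tensors whose factors are the columns
  of \<open>A\<close>, \<open>B\<close> and \<open>C\<close>; conversely any such sum arises in this
  way.\<close>

lemma tensor_act_unit_tensor:
  assumes "i < c" "j < c" "k < c"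
  shows "tensor_act c c c A B C (unit_tensor c) i j k = (\<Sum>p<c. A $$ (i, p) * B $$ (j, p) * C $$ (k, p))"
proof -
  have "tensor_act c c c A B C (unit_tensor c) i j k = (\<Sum>i'<c. \<Sum>j'<c. \<Sum>k'<c. \<Sum>p<c.
      A $$ (i, i') * B $$ (j, j') * C $$ (k, k') * (std_basis p i' * std_basis p j' * std_basis p k'))"
    using assms by (simp add: tensor_act_def unit_tensor_def sum_distrib_left)
  also have "\<dots> = (\<Sum>p<c. \<Sum>i'<c. \<Sum>j'<c. \<Sum>k'<c.
      A $$ (i, i') * B $$ (j, j') * C $$ (k, k') * (std_basis p i' * std_basis p j' * std_basis p k'))"
    by (rule sum_swap4[symmetric])
  also have "\<dots> = (\<Sum>p<c. \<Sum>i'<c. \<Sum>j'<c. \<Sum>k'<c.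
      A $$ (i, i') * std_basis p i' * (B $$ (j, j') * std_basis p j') * (C $$ (k, k') * std_basis p k') * 1)"
    by (simp add: mult_ac)
  also have "\<dots> = (\<Sum>p<c. (\<Sum>i'<c. A $$ (i, i') * std_basis p i') * (\<Sum>j'<c. B $$ (j, j') * std_basis p j') *
      (\<Sum>k'<c. C $$ (k, k') * std_basis p k') * 1)"
    by (simp only: prod3_sum)
  also have "\<dots> = (\<Sum>p<c. A $$ (i, p) * B $$ (j, p) * C $$ (k, p))"
    by (intro sum.cong refl) (simp add: sum_std_basis)
  finally show ?thesis .
qed

text \<open>
  The tensor below is, up to diagonal scaling, the multiplication of polynomials of degree at most
  \<open>1\<close> and \<open>N - 1\<close>. Evaluation and interpolation at the \<open>(N + 1)\<close>-st roots of unity shows that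
  it has rank at most \<open>N + 1\<close>. The weights are forced by the condition that the last two marginals
  are uniform.
\<close>

definition pencil_weight :: "nat \<Rightarrow> nat \<Rightarrow> nat \<Rightarrow> nat \<Rightarrow> real" where
  "pencil_weight N i j k = (if i < 2 \<and> j < N \<and> k = i + j
     then (if i = 0 then real (N - j) else real (j + 1)) / (real N * real (N + 1)) else 0)"

definition pencil_tensor :: "nat \<Rightarrow> tensor" where
  "pencil_tensor N i j k = complex_of_real (sqrt (pencil_weight N i j k))"

text \<open>The weights split as a function of \<open>j\<close> times a function of \<open>i + j\<close>, that is, as a diagonal scaling.\<close>

lemma pencil_weight_binomial:
  assumes "i < 2" "j < N"
  shows "pencil_weight N i j (i + j) = real ((N - 1) choose j) / real (N + 1) / real (N choose (i + j))"
proof -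
  obtain M where N: "N = Suc M" using assms by (cases N) auto
  have frac: "a / (n * c) = m / c / b" if "a * b = n * m" "b > 0" "n > 0" "c > 0" for a b c m n :: real
    using that by (simp add: field_simps)
  consider "i = 0" | "i = 1" using assms by linarith
  then show ?thesis
  proof cases
    case 1
    have "(N - j) * (N choose j) = N * (M choose j)"
      using binomial_absorb_comp[of N j] N by simp
    then have "real (N - j) * real (N choose j) = real N * real (M choose j)" by (metis of_nat_mult)
    then have "real (N - j) / (real N * real (N + 1)) = real (M choose j) / real (N + 1) / real (N choose j)"
      by (rule frac) (use assms in auto)
    then show ?thesis using assms 1 N by (simp add: pencil_weight_def)
  next
    case 2
    have "Suc j * (N choose Suc j) = N * (M choose j)"
      using Suc_times_binomial_eq[of M j] N by (simp add: mult.commute)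
    then have "real (Suc j) * real (N choose Suc j) = real N * real (M choose j)" by (metis of_nat_mult)
    then have "real (Suc j) / (real N * real (N + 1)) = real (M choose j) / real (N + 1) / real (N choose Suc j)"
      by (rule frac) (use assms in auto)
    then show ?thesis using assms 2 N by (simp add: pencil_weight_def)
  qed
qed

text \<open>\<open>A\<close> and \<open>B\<close> evaluate monomials at the \<open>c\<close>-th
  roots of unity and \<open>C\<close> is the inverse discrete Fourier transform; \<open>y\<close>
  and \<open>z\<close> are the diagonal scalings read off from the binomial form of the weights.
  \<open>B\<close> has a zero row, hence the closure in the claim.\<close>

lemma pencil_tensor_in_closure:
  assumes N: "1 \<le> N"
  shows "pencil_tensor N \<in> closure (GL_orbit (Suc N) (Suc N) (Suc N) (unit_tensor (Suc N)))"
proof -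
  define c where "c = Suc N"
  define e where "e s = cis (2 * pi * real s / real c)" for s
  define y where "y j = sqrt (real ((N - 1) choose j) / real c)" for j
  define z where "z k = 1 / sqrt (real (N choose k))" for k
  define A where "A = Matrix.mat c c (\<lambda>(i, p). if i < 2 then e i ^ p else 0)"
  define B where "B = Matrix.mat c c (\<lambda>(j, p). if j < N then of_real (y j) * e j ^ p else 0)"
  define C where "C = Matrix.mat c c (\<lambda>(k, p). of_real (z k / real c) * cnj (e k) ^ p)"
  have e_add: "e i * e j = e (i + j)" for i j by (simp add: e_def cis_mult distrib_left add_divide_distrib)
  have "pencil_tensor N = tensor_act c c c A B C (unit_tensor c)"
  proof (intro ext)
    fix i j k
    show "pencil_tensor N i j k = tensor_act c c c A B C (unit_tensor c) i j k"
    proof (cases "i < 2 \<and> j < N \<and> k < c")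
      case True
      \<comment> \<open>Since \<open>i \<le> 1\<close> and \<open>j \<le> N - 1\<close>, the
        exponent \<open>i + j\<close> stays below \<open>c = N + 1\<close>. There is no wrap-around
        modulo \<open>c\<close>, which is why \<open>N + 1\<close> points suffice.\<close>
      then have lt: "i < c" "j < c" "k < c" "i + j < c" using N by (auto simp: c_def)
      have "tensor_act c c c A B C (unit_tensor c) i j k =
          (\<Sum>p<c. e i ^ p * (of_real (y j) * e j ^ p) * (of_real (z k / real c) * cnj (e k) ^ p))"
        using True lt by (simp add: tensor_act_unit_tensor A_def B_def C_def)
      also have "\<dots> = of_real (y j * z k / real c) * (\<Sum>p<c. e (i + j) ^ p * cnj (e k) ^ p)"
        by (simp add: sum_distrib_left power_mult_distrib mult_ac flip: e_add)
      also have "\<dots> = (if i + j = k then of_real (y j * z k) else 0)"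
        using sum_roots_of_unity[OF lt(4,3)] lt by (simp add: e_def)
      also have "\<dots> = pencil_tensor N i j k"
      proof (cases "i + j = k")
        case k: True
        have "y j * z k = sqrt (real ((N - 1) choose j) / real (N + 1) / real (N choose k))"
          by (simp add: y_def z_def c_def real_sqrt_divide real_sqrt_mult)
        also have "\<dots> = sqrt (pencil_weight N i j k)"
          using pencil_weight_binomial[of i j N] True k by simp
        finally show ?thesis using k by (simp add: pencil_tensor_def)
      qed (simp add: pencil_tensor_def pencil_weight_def)
      finally show ?thesis ..
    next
      case False
      then have "tensor_act c c c A B C (unit_tensor c) i j k = 0"
        using tensor_act_unit_tensor[of i c j k A B C]
        by (cases "i < c \<and> j < c \<and> k < c") (auto simp: A_def B_def tensor_act_def)
      moreover have "pencil_weight N i j k = 0" using False by (auto simp: pencil_weight_def c_def)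
      ultimately show ?thesis by (simp add: pencil_tensor_def)
    qed
  qed
  then show ?thesis
    using tensor_act_in_closure_orbit[of A c B c C c "unit_tensor c"] by (simp add: A_def B_def C_def c_def)
qed

section \<open>Marginals of the weights\<close>

lemma pencil_weight_nonneg: "0 \<le> pencil_weight N i j k"
  by (simp add: pencil_weight_def)

lemma pencil_weight_sum_jk:
  assumes "1 \<le> N" "i < Suc N"
  shows "(\<Sum>j<Suc N. \<Sum>k<Suc N. pencil_weight N i j k) = (if i < 2 then 1 / 2 else 0)"
proof (cases "i < 2")
  case True
  have gauss: "(\<Sum>j<N. real (j + 1)) = real N * real (N + 1) / 2"
    by (induction N) (auto simp: field_simps)
  \<comment> \<open>Replacing \<open>j\<close> by \<open>N - 1 - j\<close> exchanges the two slices,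
    so each carries half of the mass.\<close>
  have rev: "(\<Sum>j<N. real (N - j)) = (\<Sum>j<N. real (j + 1))"
    using sum.nat_diff_reindex[of "\<lambda>j. real (j + 1)" N] by (auto intro!: sum.cong simp: of_nat_diff)
  have S: "(\<Sum>j<N. if i = 0 then real (N - j) else real (j + 1)) = real N * real (N + 1) / 2"
    by (cases "i = 0") (simp_all only: if_True if_False simp_thms rev gauss)
  have "(\<Sum>k<Suc N. pencil_weight N i j k) =
      (if j < N then (if i = 0 then real (N - j) else real (j + 1)) / (real N * real (N + 1)) else 0)" for j
  proof (cases "j < N")
    case True2: True
    then have "(\<Sum>k<Suc N. pencil_weight N i j k) = (\<Sum>k<Suc N. if k = i + j
        then (if i = 0 then real (N - j) else real (j + 1)) / (real N * real (N + 1)) else 0)"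
      using True by (intro sum.cong) (auto simp: pencil_weight_def)
    then show ?thesis using True True2 by (simp del: sum.lessThan_Suc)
  qed (simp add: pencil_weight_def)
  then have "(\<Sum>j<Suc N. \<Sum>k<Suc N. pencil_weight N i j k) =
      (\<Sum>j<N. if i = 0 then real (N - j) else real (j + 1)) / (real N * real (N + 1))"
    by (simp add: sum_divide_distrib)
  then show ?thesis unfolding S using assms True by simp
qed (simp add: pencil_weight_def)

lemma pencil_weight_sum_ik:
  assumes "1 \<le> N" "j < Suc N"
  shows "(\<Sum>i<Suc N. \<Sum>k<Suc N. pencil_weight N i j k) = (if j < N then 1 / real N else 0)"
proof (cases "j < N")
  case True
  have "(\<Sum>k<Suc N. pencil_weight N i j k) = pencil_weight N i j (i + j)" if "i < 2" for i
  proof -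
    have "(\<Sum>k<Suc N. pencil_weight N i j k) =
        (\<Sum>k<Suc N. if k = i + j then pencil_weight N i j (i + j) else 0)"
      by (intro sum.cong) (auto simp: pencil_weight_def)
    then show ?thesis using that True by (simp del: sum.lessThan_Suc)
  qed
  moreover have "(\<Sum>i<Suc N. \<Sum>k<Suc N. pencil_weight N i j k) =
      (\<Sum>k<Suc N. pencil_weight N 0 j k) + (\<Sum>k<Suc N. pencil_weight N 1 j k)"
    using assms by (intro sum_first_two) (auto simp: pencil_weight_def)
  ultimately have "(\<Sum>i<Suc N. \<Sum>k<Suc N. pencil_weight N i j k) =
      pencil_weight N 0 j (0 + j) + pencil_weight N 1 j (1 + j)" by (simp del: sum.lessThan_Suc)
  also have "\<dots> = (real (N - j) + real (j + 1)) / (real N * real (N + 1))"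
    unfolding add_divide_distrib using True by (simp add: pencil_weight_def)
  also have "real (N - j) + real (j + 1) = real (N + 1)" using True by simp
  finally show ?thesis using True by simp
qed (simp add: pencil_weight_def)

lemma pencil_weight_sum_ij:
  assumes "1 \<le> N" "k < Suc N"
  shows "(\<Sum>i<Suc N. \<Sum>j<Suc N. pencil_weight N i j k) = 1 / real (Suc N)"
proof -
  have "(\<Sum>i<Suc N. \<Sum>j<Suc N. pencil_weight N i j k) =
      (\<Sum>j<Suc N. pencil_weight N 0 j k) + (\<Sum>j<Suc N. pencil_weight N 1 j k)"
    using assms by (intro sum_first_two) (auto simp: pencil_weight_def)
  \<comment> \<open>For \<open>k = N\<close> the formula gives \<open>0\<close>, in agreement with
    the missing entry at \<open>j = N\<close>. Likewise the second slice has no entry with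
    \<open>k = 0\<close>, where the value \<open>k / (N (N + 1))\<close> vanishes.\<close>
  moreover have "(\<Sum>j<Suc N. pencil_weight N 0 j k) = real (N - k) / (real N * real (N + 1))"
  proof -
    have "(\<Sum>j<Suc N. pencil_weight N 0 j k) =
        (\<Sum>j<Suc N. if j = k then real (N - k) / (real N * real (N + 1)) else 0)"
      using assms by (intro sum.cong) (auto simp: pencil_weight_def)
    then show ?thesis using assms by (simp del: sum.lessThan_Suc)
  qed
  moreover have "(\<Sum>j<Suc N. pencil_weight N 1 j k) = real k / (real N * real (N + 1))"
  proof (cases k)
    case (Suc h)
    have "(\<Sum>j<Suc N. pencil_weight N 1 j k) =
        (\<Sum>j<Suc N. if j = h then real k / (real N * real (N + 1)) else 0)"
      using assms Suc by (intro sum.cong) (auto simp: pencil_weight_def)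
    then show ?thesis using assms Suc by (simp del: sum.lessThan_Suc)
  qed (simp add: pencil_weight_def)
  moreover have "real (N - k) + real k = real N" using assms by simp
  ultimately show ?thesis using assms by (simp del: sum.lessThan_Suc flip: add_divide_distrib)
qed

lemma sorted_rev_pad_uniform: "sorted (rev (pad m (uniform_vec l)))"
  by (simp add: pad_def uniform_vec_def sorted_append)

lemma length_pad_uniform: "l \<le> m \<Longrightarrow> length (pad m (uniform_vec l)) = m"
  by (simp add: pad_def uniform_vec_def)

lemma spec_eq_pad_uniform:
  assumes "l \<le> m" "M \<in> carrier_mat m m"
    and "\<And>i j. i < m \<Longrightarrow> j < m \<Longrightarrow>
      M $$ (i, j) = (if i = j then complex_of_real (if i < l then 1 / real l else 0) else 0)"
  shows "spec M = pad m (uniform_vec l)"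
proof -
  have "M = Matrix.mat m m (\<lambda>(i, j). if i = j then complex_of_real (pad m (uniform_vec l) ! i) else 0)"
    using assms by (intro eq_matI) (auto simp: nth_pad_uniform)
  then show ?thesis
    using spec_diagonal[OF length_pad_uniform[OF assms(1)] sorted_rev_pad_uniform] by simp
qed

lemma p_point_in_unit_polytope:
  assumes c: "2 \<le> c"
  shows "pad3 c (p_point c) \<in> unit_polytope c"
proof -
  obtain N where N: "c = Suc N" "1 \<le> N" using c by (cases c) auto
  let ?T = "pencil_tensor N"
  have sq: "cnj (?T i j k) * ?T i j k = complex_of_real (pencil_weight N i j k)" for i j k
    by (simp add: pencil_tensor_def pencil_weight_nonneg flip: of_real_mult)
  \<comment> \<open>On the support \<open>k = i + j\<close>, any two indices determine the third.
    Hence all three moment matrices are diagonal and their entries are sums of weights.\<close>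
  have off: "cnj (?T i j k) * ?T i' j k = 0" if "i \<noteq> i'" for i i' j k
    using that by (auto simp: pencil_tensor_def pencil_weight_def)
  have off2: "cnj (?T i j k) * ?T i j' k = 0" if "j \<noteq> j'" for i j j' k
    using that by (auto simp: pencil_tensor_def pencil_weight_def)
  have off3: "cnj (?T i j k) * ?T i j k' = 0" if "k \<noteq> k'" for i j k k'
    using that by (auto simp: pencil_tensor_def pencil_weight_def)
  have "(cmod (?T i j k))\<^sup>2 = pencil_weight N i j k" for i j k
    by (simp add: pencil_tensor_def pencil_weight_nonneg)
  then have "(\<Sum>i<c. \<Sum>j<c. \<Sum>k<c. (cmod (?T i j k))\<^sup>2) = (\<Sum>i<c. if i < 2 then 1 / 2 else 0)"
    using pencil_weight_sum_jk[OF N(2)] by (simp add: N(1) del: sum.lessThan_Suc)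
  also have "\<dots> = 1" using c by (subst sum_first_two) auto
  finally have norm: "tensor_norm c c c ?T = 1" by (simp add: tensor_norm_def)
  have "spec (moment1 c c c ?T) = pad c (uniform_vec 2)"
  proof (rule spec_eq_pad_uniform[OF c moment_carrier(1)])
    fix i i' assume i: "i < c" "i' < c"
    show "moment1 c c c ?T $$ (i, i') = (if i = i' then complex_of_real (if i < 2 then 1 / real 2 else 0) else 0)"
    proof (cases "i = i'")
      case True
      then show ?thesis using pencil_weight_sum_jk[OF N(2), of i] i
        by (simp add: index_moment1 norm[unfolded N(1)] sq N(1) del: sum.lessThan_Suc flip: of_real_sum)
    qed (use i in \<open>simp add: index_moment1 off\<close>)
  qed
  moreover have "spec (moment2 c c c ?T) = pad c (uniform_vec N)"
  proof (rule spec_eq_pad_uniform[OF _ moment_carrier(2)])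
    fix i i' assume i: "i < c" "i' < c"
    show "moment2 c c c ?T $$ (i, i') = (if i = i' then complex_of_real (if i < N then 1 / real N else 0) else 0)"
    proof (cases "i = i'")
      case True
      then show ?thesis using pencil_weight_sum_ik[OF N(2), of i] i
        by (simp add: index_moment2 norm[unfolded N(1)] sq N(1) del: sum.lessThan_Suc flip: of_real_sum)
    qed (use i in \<open>simp add: index_moment2 off2\<close>)
  qed (simp add: N)
  moreover have "spec (moment3 c c c ?T) = pad c (uniform_vec c)"
  proof (rule spec_eq_pad_uniform[OF _ moment_carrier(3)])
    fix i i' assume i: "i < c" "i' < c"
    show "moment3 c c c ?T $$ (i, i') = (if i = i' then complex_of_real (if i < c then 1 / real c else 0) else 0)"
    proof (cases "i = i'")
      case True
      then show ?thesis using pencil_weight_sum_ij[OF N(2), of i] i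
        by (simp add: index_moment3 norm[unfolded N(1)] sq N(1) del: sum.lessThan_Suc of_nat_Suc flip: of_real_sum)
    qed (use i in \<open>simp add: index_moment3 off3\<close>)
  qed simp
  ultimately have "pad3 c (p_point c) = spec_moment c c c ?T"
    by (simp add: pad3_def p_point_def spec_moment_def N(1))
  moreover have "?T \<noteq> (\<lambda>_ _ _. 0)" using norm by (auto simp: tensor_norm_def)
  moreover have "?T \<in> closure (GL_orbit c c c (unit_tensor c))"
    using pencil_tensor_in_closure[OF N(2)] by (simp add: N(1))
  ultimately show ?thesis unfolding moment_polytope_def by blast
qed

lemma pad_pad: "length xs \<le> c \<Longrightarrow> c \<le> m \<Longrightarrow> pad m (pad c xs) = pad m xs"
  by (simp add: pad_def flip: replicate_add)

text \<open>The bound \<open>2 \<le> n\<close> in the last claim excludes \<open>n = 1\<close>,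
  where the unit tensor and the matrix multiplication tensor coincide, and \<open>n = 0\<close>,
  where both polytopes are empty. For larger \<open>n\<close> the choice
  \<open>c = n\<^sup>2\<close> is admissible.\<close>

theorem theorem1p4:
  shows "(\<forall>n c :: nat. 0 < n \<and> 0 < c \<and> n\<^sup>2 - n + 1 < c \<and> c \<le> n\<^sup>2 \<longrightarrow>
            pad3 c (p_point c) \<in> unit_polytope c \<and>
            pad3 (n\<^sup>2) (p_point c) \<notin> matmul_polytope n \<and>
            \<not> pad3 (n\<^sup>2) ` unit_polytope c \<subseteq> matmul_polytope n) \<and>
         (\<forall>n :: nat. 2 \<le> n \<longrightarrow> \<not> unit_polytope (n\<^sup>2) \<subseteq> matmul_polytope n)"
proof (intro conjI allI impI)
  fix n c :: nat
  assume *: "0 < n \<and> 0 < c \<and> n\<^sup>2 - n + 1 < c \<and> c \<le> n\<^sup>2"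
  \<comment> \<open>For \<open>n = 1\<close> the range \<open>1 < c \<le> 1\<close> is
    empty.\<close>
  then have "n \<noteq> 1" by auto
  then have n: "2 \<le> n" and c: "2 \<le> c" using * by auto
  show unit: "pad3 c (p_point c) \<in> unit_polytope c" by (rule p_point_in_unit_polytope[OF c])
  show notin: "pad3 (n\<^sup>2) (p_point c) \<notin> matmul_polytope n"
    using * by (intro p_point_notin_matmul_polytope[OF n]) auto
  have "pad3 (n\<^sup>2) (pad3 c (p_point c)) = pad3 (n\<^sup>2) (p_point c)"
    using * c by (simp add: pad3_def p_point_def pad_pad uniform_vec_def)
  then show "\<not> pad3 (n\<^sup>2) ` unit_polytope c \<subseteq> matmul_polytope n" using unit notin by (metis image_subset_iff)
next
  fix n :: nat assume n: "2 \<le> n"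
  have "2 * n \<le> n\<^sup>2" unfolding power2_eq_square using n by (intro mult_le_mono1)
  then have c: "n\<^sup>2 - n + 1 < n\<^sup>2" "2 \<le> n\<^sup>2" using n by auto
  show "\<not> unit_polytope (n\<^sup>2) \<subseteq> matmul_polytope n"
    using p_point_in_unit_polytope[OF c(2)] p_point_notin_matmul_polytope[OF n c(1)] by blast
qed

end
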